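(* There is an absolute constant $C>0$ such that the following holds. Let $L>0$, $A\in[-L,L]^{n\times m}$, $\epsilon\in(0,1)$, and $k=\max\{C\max\{\log^2n,\log^2m\}/\epsilon^2,\ (1/\epsilon)^{C/\epsilon^2}\}$. Let $t\le k$ be a positive integer. Consider the randomized procedure: let $S_R\subseteq\{1,\dots,n\}$ include each index independently with probability $k/n$ and $S_C\subseteq\{1,\dots,m\}$ include each index independently with probability $k/m$; if $|S_R|>2k$ or $|S_C|>2k$, abort; otherwise, for $r\in\{t-1,t\}$ compute $$\tilde\Lambda_r=\frac{nm}{|S_R||S_C|}\min_{\substack{\bm u^1,\dots,\bm u^r\in\mathbb{R}^{|S_R|}\\ \bm v^1,\dots,\bm v^r\in\mathbb{R}^{|S_C|}}}\Big\|A|_{S_R\times S_C}-\sum_{\ell=1}^r\bm u^\ell(\bm v^\ell)^\top\Big\|_F^2$$ (with the empty sum equal to $0$ when $r=0$), and output $z=\sqrt{\tilde\Lambda_{t-1}-\tilde\Lambda_t}$. Then with probability at least $2/3$ the procedure outputs $z$ with $|\sigma_t(A)-z|\le L\sqrt{\epsilon tnm}$.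
   Context: $\sigma_t(A)$ is the $t$-th largest singular value of $A$, $\|\cdot\|_F$ is the Frobenius norm, and $A|_{S_R\times S_C}$ is the submatrix of $A$ with rows indexed by $S_R$ and columns indexed by $S_C$. *)

theory Defs
  imports
    "HOL-Probability.Probability"
    "Jordan_Normal_Form.DL_Submatrix"
    "Jordan_Normal_Form.Char_Poly"
begin

hide_const (open) Finite_Cartesian_Product.vec Finite_Cartesian_Product.mat

text \<open>
  All matrices are the dimension-carrying matrices of \<open>Jordan_Normal_Form\<close>, so that the dimensions
  can be quantified after the absolute constant. Rows and columns are indexed from 0.
\<close>

text \<open>
  The list has one entry for each column of \<open>A\<close>, in decreasing order and with multiplicity: the
  square roots of the eigenvalues of \<open>A\<^sup>T A\<close>. If \<open>A\<close> has more columns than rows, this is the usual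
  list of \<open>min n m\<close> singular values followed by zeros.
\<close>

definition singular_values :: "real mat \<Rightarrow> real list" where
  "singular_values A =
     rev (sorted_list_of_multiset (image_mset sqrt (proots (char_poly (transpose_mat A * A)))))"

text \<open>\<open>t\<close> is counted from 1; singular values beyond the dimensions of the matrix are 0.\<close>

definition singular_value :: "nat \<Rightarrow> real mat \<Rightarrow> real" where
  "singular_value t A = (if 1 \<le> t \<and> t \<le> length (singular_values A) then singular_values A ! (t - 1) else 0)"

definition frobenius_norm :: "real mat \<Rightarrow> real" where
  "frobenius_norm A = sqrt (\<Sum>i<dim_row A. \<Sum>j<dim_col A. (A $$ (i, j))\<^sup>2)"

text \<open>The matrix \<open>\<Sum>\<^sub>l u\<^sup>l (v\<^sup>l)\<^sup>T\<close> of dimension \<open>p \<times> q\<close>, with \<open>l\<close> ranging over \<open>{..<r}\<close>.\<close>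

definition sum_outer :: "nat \<Rightarrow> nat \<Rightarrow> nat \<Rightarrow> (nat \<Rightarrow> real vec) \<Rightarrow> (nat \<Rightarrow> real vec) \<Rightarrow> real mat" where
  "sum_outer p q r u v = mat p q (\<lambda>(i, j). \<Sum>l<r. vec_index (u l) i * vec_index (v l) j)"

text \<open>The set is nonempty and bounded below by 0, and its infimum is attained (by a truncated
  singular value decomposition), so \<open>Inf\<close> is the minimum.\<close>

definition low_rank_error :: "nat \<Rightarrow> real mat \<Rightarrow> real" where
  "low_rank_error r B =
     Inf {(frobenius_norm (B - sum_outer (dim_row B) (dim_col B) r u v))\<^sup>2 | u v.
            (\<forall>l<r. u l \<in> carrier_vec (dim_row B)) \<and> (\<forall>l<r. v l \<in> carrier_vec (dim_col B))}"

definition Lambda_tilde :: "real mat \<Rightarrow> nat set \<Rightarrow> nat set \<Rightarrow> nat \<Rightarrow> real" where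
  "Lambda_tilde A SR SC r =
     real (dim_row A) * real (dim_col A) / (real (card SR) * real (card SC))
       * low_rank_error r (submatrix A SR SC)"

text \<open>Each index is kept independently with probability \<open>p\<close>, read as 1 if \<open>p > 1\<close>.\<close>

definition random_subset :: "nat \<Rightarrow> real \<Rightarrow> nat set pmf" where
  "random_subset n p =
     map_pmf (\<lambda>f. {i. i < n \<and> f i}) (Pi_pmf {..<n} False (\<lambda>_. bernoulli_pmf (min 1 p)))"

text \<open>
  \<open>None\<close> means that there is no output: either the procedure aborts, or one of the samples is empty
  and the normalising factor \<open>nm / (|S\<^sub>R| |S\<^sub>C|)\<close> is undefined.
\<close>

definition sv_procedure :: "real mat \<Rightarrow> real \<Rightarrow> nat \<Rightarrow> real option pmf" where
  "sv_procedure A k t =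
     bind_pmf (random_subset (dim_row A) (k / real (dim_row A))) (\<lambda>SR.
     bind_pmf (random_subset (dim_col A) (k / real (dim_col A))) (\<lambda>SC.
       return_pmf
         (if real (card SR) > 2 * k \<or> real (card SC) > 2 * k \<or> SR = {} \<or> SC = {} then None
          else Some (sqrt (Lambda_tilde A SR SC (t - 1) - Lambda_tilde A SR SC t)))))"

definition sample_size :: "real \<Rightarrow> nat \<Rightarrow> nat \<Rightarrow> real \<Rightarrow> real" where
  "sample_size C n m \<epsilon> =
     max (C * max ((ln (real n))\<^sup>2) ((ln (real m))\<^sup>2) / \<epsilon>\<^sup>2) ((1 / \<epsilon>) powr (C / \<epsilon>\<^sup>2))"

end

theory Submission
  imports Defs "Jordan_Normal_Form.Spectral_Radius"
begin

text \<open>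
  By the Eckart--Young theorem, \<open>\<sigma>\<^sub>t(B)\<^sup>2\<close> is the difference of the errors of the best approximations
  of \<open>B\<close> of rank \<open>t - 1\<close> and \<open>t\<close>, so the output of the procedure is \<open>\<sigma>\<^sub>t\<close> of the sampled submatrix,
  rescaled. With probability at least 5/6, the Gram matrix of the \<open>N\<close> sampled rows, divided by \<open>N\<close>,
  differs from \<open>A\<^sup>T A / n\<close> by at most \<open>O(m L\<^sup>2 / sqrt k)\<close> in Frobenius norm: its entries are sums of
  independent terms, so this is a variance computation. By Weyl's inequality, \<open>\<sigma>\<^sub>t\<^sup>2 / n\<close> changes by at
  most that much. As the singular values are invariant under transposition, the same holds
  for the columns of the matrix of sampled rows. Altogether \<open>\<sigma>\<^sub>t\<^sup>2\<close> is estimated up to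
  \<open>O(n m L\<^sup>2 / sqrt k)\<close>, which is at most \<open>\<epsilon> n m L\<^sup>2\<close> because \<open>k \<ge> C (ln 2)\<^sup>2 / \<epsilon>\<^sup>2\<close> as soon as one of
  the dimensions is at least 2; finally \<open>\<bar>\<sigma> - z\<bar>\<^sup>2 \<le> \<bar>\<sigma>\<^sup>2 - z\<^sup>2\<bar>\<close>.
\<close>

no_notation Finite_Cartesian_Product.vec_nth (infixl "$" 90)
no_notation inner (infix "\<bullet>" 70)

section \<open>The spectral theorem for real symmetric matrices\<close>

lemma symmetric_bilinear_sum:
  fixes g :: "nat \<Rightarrow> nat \<Rightarrow> real"
  assumes "\<And>i j. i < n \<Longrightarrow> j < n \<Longrightarrow> g i j = g j i"
  shows "(\<Sum>i<n. y i * (\<Sum>j<n. g i j * x j)) = (\<Sum>i<n. x i * (\<Sum>j<n. g i j * y j))"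
proof -
  have "(\<Sum>i<n. y i * (\<Sum>j<n. g i j * x j)) = (\<Sum>i<n. \<Sum>j<n. y i * g i j * x j)"
    by (simp add: sum_distrib_left mult.assoc)
  also have "\<dots> = (\<Sum>j<n. \<Sum>i<n. y i * g i j * x j)" by (rule sum.swap)
  also have "\<dots> = (\<Sum>j<n. \<Sum>i<n. x j * (g j i * y i))"
    by (intro sum.cong refl) (simp add: assms)
  finally show ?thesis by (simp add: sum_distrib_left)
qed

text \<open>Comparing \<open>y \<bullet> Gx\<close> with \<open>x \<bullet> Gy\<close> for a complex eigenvector \<open>x + iy\<close> shows that its eigenvalue
  is real, so that \<open>x\<close> or \<open>y\<close> is a real eigenvector.\<close>

lemma symmetric_real_eigenvector:
  fixes G :: "real mat"
  assumes G: "G \<in> carrier_mat n n" and sym: "transpose_mat G = G" and n: "n > 0"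
  obtains v e where "v \<in> carrier_vec n" "v \<noteq> 0\<^sub>v n" "G *\<^sub>v v = e \<cdot>\<^sub>v v"
proof -
  let ?A = "map_mat complex_of_real G"
  have A: "?A \<in> carrier_mat n n" using G by simp
  from spectrum_non_empty[OF A n] obtain l where "eigenvalue ?A l"
    unfolding spectrum_def by auto
  then obtain z where z: "z \<in> carrier_vec n" "z \<noteq> 0\<^sub>v n" "?A *\<^sub>v z = l \<cdot>\<^sub>v z"
    unfolding eigenvalue_def eigenvector_def using A G by auto
  have gsym: "G $$ (i, j) = G $$ (j, i)" if "i < n" "j < n" for i j
    using that G by (subst (1) sym[symmetric]) simp
  have ev: "(\<Sum>j<n. complex_of_real (G $$ (i, j)) * z $ j) = l * z $ i" if "i < n" for i
  proof -
    have "(?A *\<^sub>v z) $ i = (\<Sum>j<n. complex_of_real (G $$ (i, j)) * z $ j)"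
      using that z(1) G by (simp add: scalar_prod_def atLeast0LessThan)
    then show ?thesis using z that by simp
  qed
  define x where "x i = Re (z $ i)" for i
  define y where "y i = Im (z $ i)" for i
  have ex: "(\<Sum>j<n. G $$ (i, j) * x j) = Re l * x i - Im l * y i" if "i < n" for i
    using arg_cong[OF ev[OF that], of Re] by (simp add: x_def y_def)
  have ey: "(\<Sum>j<n. G $$ (i, j) * y j) = Re l * y i + Im l * x i" if "i < n" for i
    using arg_cong[OF ev[OF that], of Im] by (simp add: x_def y_def)
  have "(\<Sum>i<n. y i * (Re l * x i - Im l * y i)) = (\<Sum>i<n. x i * (Re l * y i + Im l * x i))"
    using symmetric_bilinear_sum[of n "\<lambda>i j. G $$ (i, j)" y x] gsym ex ey by simp
  then have "(\<Sum>i<n. x i * (Re l * y i + Im l * x i) - y i * (Re l * x i - Im l * y i)) = 0"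
    by (simp add: sum_subtractf)
  also have "(\<Sum>i<n. x i * (Re l * y i + Im l * x i) - y i * (Re l * x i - Im l * y i)) =
      Im l * (\<Sum>i<n. (x i)\<^sup>2 + (y i)\<^sup>2)"
    unfolding sum_distrib_left by (intro sum.cong refl) (simp add: algebra_simps power2_eq_square)
  finally have prod0: "Im l * (\<Sum>i<n. (x i)\<^sup>2 + (y i)\<^sup>2) = 0" .
  obtain i0 where i0: "i0 < n" "z $ i0 \<noteq> 0"
    using z by (metis carrier_vecD eq_vecI index_zero_vec)
  have "(\<Sum>i<n. (x i)\<^sup>2 + (y i)\<^sup>2) > 0"
    using i0 by (intro sum_pos2[of _ i0])
      (auto simp: x_def y_def complex_eq_iff sum_power2_gt_zero_iff)
  with prod0 have im: "Im l = 0" by simp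
  show thesis
  proof (cases "x i0 = 0")
    case False
    show thesis
    proof (rule that[of "vec n x" "Re l"])
      show "vec n x \<noteq> 0\<^sub>v n" using False i0 by (metis index_vec index_zero_vec(1))
      show "G *\<^sub>v vec n x = Re l \<cdot>\<^sub>v vec n x"
        using G ex im by (intro eq_vecI) (auto simp: scalar_prod_def atLeast0LessThan)
    qed simp
  next
    case True
    then have y0: "y i0 \<noteq> 0" using i0 by (auto simp: x_def y_def complex_eq_iff)
    show thesis
    proof (rule that[of "vec n y" "Re l"])
      show "vec n y \<noteq> 0\<^sub>v n" using y0 i0 by (metis index_vec index_zero_vec(1))
      show "G *\<^sub>v vec n y = Re l \<cdot>\<^sub>v vec n y"
        using G ey im by (intro eq_vecI) (auto simp: scalar_prod_def atLeast0LessThan)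
    qed simp
  qed
qed

text \<open>The Householder reflection in the direction \<open>u - e\<^sub>0\<close>; if \<open>u = e\<^sub>0\<close>, division by zero makes it
  the identity, as desired.\<close>

lemma householder_reflection:
  fixes u :: "real vec"
  assumes u: "u \<in> carrier_vec (Suc n)" and unit: "u \<bullet> u = 1"
  obtains W where "W \<in> carrier_mat (Suc n) (Suc n)" "transpose_mat W = W"
    "W * W = 1\<^sub>m (Suc n)" "col W 0 = u"
proof -
  define w where "w i = u $ i - (if i = 0 then 1 else 0)" for i
  define s where "s = (\<Sum>i<Suc n. (w i)\<^sup>2)"
  define W where "W = mat (Suc n) (Suc n) (\<lambda>(i, j). (if i = j then 1 else 0) - 2 / s * w i * w j)"
  have uu: "(\<Sum>i<Suc n. (u $ i)\<^sup>2) = 1"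
    using unit u by (simp add: scalar_prod_def atLeast0LessThan power2_eq_square)
  \<comment> \<open>As \<open>u\<close> is a unit vector, |u - e_0|^2 = 2 - 2 u_0, that is
    \<open>w 0 = - s / 2\<close>; this makes column 0 of \<open>W\<close> equal to e_0 + w =
    u.\<close>
  have "s = (\<Sum>i<Suc n. (u $ i)\<^sup>2 + (if i = 0 then 1 - 2 * u $ 0 else 0))"
    unfolding s_def w_def by (intro sum.cong refl) (auto simp: power2_eq_square algebra_simps)
  also have "\<dots> = 2 - 2 * u $ 0"
    using uu unfolding sum.distrib by (subst sum.delta) auto
  finally have s: "s = 2 - 2 * u $ 0" .
  have w0: "w i = 0" if "s = 0" "i < Suc n" for i
    using that unfolding s_def by (subst (asm) sum_nonneg_eq_0_iff) auto
  show thesis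
  proof (rule that[of W])
    show "W * W = 1\<^sub>m (Suc n)"
    proof (rule eq_matI)
      fix i j assume "i < dim_row (1\<^sub>m (Suc n) :: real mat)" "j < dim_col (1\<^sub>m (Suc n) :: real mat)"
      then have ij: "i < Suc n" "j < Suc n" by auto
      have "(W * W) $$ (i, j) = (\<Sum>k<Suc n. ((if i = k then 1 else 0) - 2 / s * w i * w k)
          * ((if k = j then 1 else 0) - 2 / s * w k * w j))"
        using ij by (simp add: W_def scalar_prod_def atLeast0LessThan)
      also have "\<dots> = (\<Sum>k<Suc n. (if k = i then (if i = j then 1 else 0) else 0)
         - (if k = i then 2 / s * w i * w j else 0) - (if k = j then 2 / s * w i * w j else 0)
         + (2 / s)\<^sup>2 * w i * w j * (w k)\<^sup>2)"
        by (intro sum.cong refl) (auto simp: algebra_simps power2_eq_square)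
      also have "\<dots> = (if i = j then 1 else 0) - 2 / s * w i * w j - 2 / s * w i * w j
           + (2 / s)\<^sup>2 * w i * w j * s"
        unfolding sum.distrib sum_subtractf sum_distrib_left[symmetric] s_def[symmetric]
        using ij by (simp del: sum.lessThan_Suc)
      \<comment> \<open>For \<open>s = 0\<close> all terms with \<open>2 / s\<close> vanish;
        otherwise the coefficients cancel, -4/s + (4/s^2) s = 0.\<close>
      also have "\<dots> = (if i = j then 1 else 0)"
        by (cases "s = 0") (auto simp: power2_eq_square field_simps)
      finally show "(W * W) $$ (i, j) = 1\<^sub>m (Suc n) $$ (i, j)" using ij by simp
    qed (auto simp: W_def)
    show "col W 0 = u"
    proof (rule eq_vecI)
      fix i assume "i < dim_vec u"
      then have i: "i < Suc n" using u by auto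
      have "col W 0 $ i = (if i = 0 then 1 else 0) - 2 / s * w i * w 0" using i by (simp add: W_def)
      also have "\<dots> = (if i = 0 then 1 else 0) + w i"
      proof (cases "s = 0")
        case True
        then show ?thesis using w0[OF _ i] by simp
      next
        case False
        moreover have "w 0 = - s / 2" by (simp add: w_def s)
        ultimately show ?thesis by simp
      qed
      finally show "col W 0 $ i = u $ i" by (simp add: w_def)
    qed (use u in \<open>simp add: W_def\<close>)
  qed (auto simp: W_def intro!: eq_matI)
qed

definition diag_of :: "nat \<Rightarrow> (nat \<Rightarrow> real) \<Rightarrow> real mat" where
  "diag_of n d = mat n n (\<lambda>(i, j). if i = j then d i else 0)"

lemma diag_of_carrier [simp]: "diag_of n d \<in> carrier_mat n n"
  by (simp add: diag_of_def)

lemma four_block_diag_of: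
  "four_block_mat (mat 1 1 (\<lambda>_. e)) (0\<^sub>m 1 n) (0\<^sub>m n 1) (diag_of n d) = diag_of (Suc n) (case_nat e d)"
  by (rule eq_matI) (auto simp: diag_of_def split: nat.splits)

text \<open>Induction on \<open>n\<close> by deflation. Conjugation with a reflection
  \<open>W\<close> taking e_0 to a unit eigenvector turns column 0 into a multiple of e_0, and by
  symmetry row 0 too. What remains is a smaller symmetric block, diagonalised by the induction
  hypothesis.\<close>

theorem real_spectral_theorem:
  fixes G :: "real mat"
  assumes "G \<in> carrier_mat n n" "transpose_mat G = G"
  shows "\<exists>U d. U \<in> carrier_mat n n \<and> U * transpose_mat U = 1\<^sub>m n \<and> transpose_mat U * U = 1\<^sub>m n \<and>
    G = U * diag_of n d * transpose_mat U"
  using assms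
proof (induction n arbitrary: G)
  case 0
  then show ?case by (intro exI[of _ "1\<^sub>m 0"]) (auto intro!: eq_matI)
next
  case (Suc n)
  note G = Suc.prems(1) and sym = Suc.prems(2)
  let ?N = "Suc n"
  obtain v e where v: "v \<in> carrier_vec ?N" "v \<noteq> 0\<^sub>v ?N" "G *\<^sub>v v = e \<cdot>\<^sub>v v"
    using symmetric_real_eigenvector[OF G sym] by auto
  have vv: "v \<bullet> v > 0" using v(1,2) conjugate_square_greater_0_vec[of v ?N] by simp
  define u where "u = (1 / sqrt (v \<bullet> v)) \<cdot>\<^sub>v v"
  have u: "u \<in> carrier_vec ?N" "G *\<^sub>v u = e \<cdot>\<^sub>v u" "u \<bullet> u = 1"
    using v vv G unfolding u_def
    by (auto simp: mult_mat_vec smult_smult_assoc mult.commute)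
  obtain W where W: "W \<in> carrier_mat ?N ?N" "transpose_mat W = W" "W * W = 1\<^sub>m ?N" "col W 0 = u"
    using householder_reflection[OF u(1,3)] .
  define H where "H = W * G * W"
  have H: "H \<in> carrier_mat ?N ?N" using W G by (simp add: H_def)
  have "transpose_mat H = H"
    using W G sym unfolding H_def by (simp add: transpose_mult[of _ ?N ?N _ ?N] assoc_mult_mat[of _ ?N ?N _ ?N _ ?N])
  then have Hsym: "H $$ (i, j) = H $$ (j, i)" if "i < ?N" "j < ?N" for i j
    using that H by (metis index_transpose_mat(1) carrier_matD)
  \<comment> \<open>Column 0 of \<open>H\<close> is W G u = e W u, and W u = W W e_0 = e_0.\<close>
  have "col H 0 = W *\<^sub>v (G *\<^sub>v col W 0)"
    using W G u(1) unfolding H_def by (subst col_mult2[of _ ?N ?N _ ?N]) (auto intro!: assoc_mult_mat_vec)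
  also have "\<dots> = e \<cdot>\<^sub>v (W *\<^sub>v col W 0)" using u W G by (simp add: mult_mat_vec)
  also have "W *\<^sub>v col W 0 = col (W * W) 0" using W(1) by (subst col_mult2) auto
  finally have colH: "col H 0 = e \<cdot>\<^sub>v unit_vec ?N 0" using W by simp
  have H0: "H $$ (i, 0) = (if i = 0 then e else 0)" if "i < ?N" for i
    using arg_cong[OF colH, of "\<lambda>v. v $ i"] that H by (auto simp: unit_vec_def)
  define G' where "G' = mat n n (\<lambda>(i, j). H $$ (Suc i, Suc j))"
  have G': "G' \<in> carrier_mat n n" by (simp add: G'_def)
  have "transpose_mat G' = G'" by (rule eq_matI) (auto simp: G'_def Hsym)
  from Suc.IH[OF G' this] obtain U' d where U': "U' \<in> carrier_mat n n"
    "U' * transpose_mat U' = 1\<^sub>m n" "transpose_mat U' * U' = 1\<^sub>m n"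
    "G' = U' * diag_of n d * transpose_mat U'" by blast
  let ?B = "\<lambda>e M. four_block_mat (mat 1 1 (\<lambda>_. e :: real)) (0\<^sub>m 1 n) (0\<^sub>m n 1) M"
  have mult: "?B a M * ?B b M' = ?B (a * b) (M * M')"
    if "M \<in> carrier_mat n n" "M' \<in> carrier_mat n n" for a b M M'
    using that by (subst mult_four_block_mat[of _ 1 1 _ n _ n _ _ 1 _ n])
      (auto intro!: arg_cong2[where f = "\<lambda>a b. four_block_mat a _ _ b"] eq_matI simp: scalar_prod_def)
  have trans: "transpose_mat (?B a M) = ?B a (transpose_mat M)" if "M \<in> carrier_mat n n" for a M
    using that by (subst transpose_four_block_mat[of _ 1 1 _ n _ n])
      (auto intro!: arg_cong2[where f = "\<lambda>a b. four_block_mat a _ _ b"] eq_matI)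
  have one: "?B 1 (1\<^sub>m n) = 1\<^sub>m ?N" by (rule eq_matI) auto
  have HB: "H = ?B e G'"
  proof (rule eq_matI)
    fix i j assume "i < dim_row (?B e G')" "j < dim_col (?B e G')"
    then have "i < ?N" "j < ?N" by (auto simp: G'_def)
    then show "H $$ (i, j) = ?B e G' $$ (i, j)"
      using H0 Hsym[of i j] by (cases i; cases j) (auto simp: G'_def)
  qed (use H in \<open>auto simp: G'_def\<close>)
  define V where "V = ?B 1 U'"
  have V: "V \<in> carrier_mat ?N ?N"
    using four_block_carrier_mat[of "mat 1 1 (\<lambda>_. 1 :: real)" 1 1 U' n n] U'(1)
    by (simp add: V_def)
  have V': "V * transpose_mat V = 1\<^sub>m ?N" "transpose_mat V * V = 1\<^sub>m ?N"
    using U' V unfolding V_def by (simp_all add: trans mult one del: One_nat_def)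
  have "transpose_mat V \<in> carrier_mat ?N ?N" using V by simp
  note V = V this V'
  have HV: "H = V * diag_of ?N (case_nat e d) * transpose_mat V"
    unfolding V_def HB U'(4) four_block_diag_of[symmetric] using U'(1) by (simp add: trans mult del: One_nat_def)
  let ?D = "diag_of ?N (case_nat e d)"
  have assoc: "\<And>A B C. A \<in> carrier_mat ?N ?N \<Longrightarrow> B \<in> carrier_mat ?N ?N \<Longrightarrow> C \<in> carrier_mat ?N ?N
    \<Longrightarrow> (A * B) * C = A * (B * (C :: real mat))" by (rule assoc_mult_mat)
  have carr: "\<And>A B. A \<in> carrier_mat ?N ?N \<Longrightarrow> B \<in> carrier_mat ?N ?N \<Longrightarrow> A * (B :: real mat) \<in> carrier_mat ?N ?N"
    by (rule mult_carrier_mat)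
  \<comment> \<open>Products are bracketed to the right by \<open>assoc\<close>; these rules then
    cancel adjacent inverse factors inside longer products.\<close>
  have cancelW: "W * (W * M) = M" if "M \<in> carrier_mat ?N ?N" for M
    using assoc[OF W(1) W(1) that] W that by simp
  have cancelV: "V * (transpose_mat V * M) = M" "transpose_mat V * (V * M) = M" if "M \<in> carrier_mat ?N ?N" for M
    using assoc[OF V(1,2) that] assoc[OF V(2,1) that] V that by simp_all
  have "G = W * H * W" unfolding H_def using W G by (simp add: assoc carr cancelW)
  moreover have tWV: "transpose_mat (W * V) = transpose_mat V * W"
    using W V by (simp add: transpose_mult[of _ ?N ?N _ ?N])
  ultimately have "G = W * V * ?D * transpose_mat (W * V)"
    unfolding HV using W(1) V by (simp add: assoc carr)
  moreover have "W * V * transpose_mat (W * V) = 1\<^sub>m ?N" "transpose_mat (W * V) * (W * V) = 1\<^sub>m ?N"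
    unfolding tWV using W V by (simp_all add: assoc carr cancelW cancelV)
  ultimately show ?case using W(1) V(1) by (intro exI[of _ "W * V"] exI[of _ "case_nat e d"]) simp
qed

section \<open>Comparison of eigenvalues\<close>

text \<open>An orthonormal basis of eigenvectors \<open>u i\<close> with eigenvalues in decreasing
  order, counted from 0. Orthonormality and completeness are both recorded, so that either is at
  hand without inverting a matrix; functions replace matrices so that only finite sums
  occur.\<close>

definition eigensystem :: "nat \<Rightarrow> (nat \<Rightarrow> nat \<Rightarrow> real) \<Rightarrow> (nat \<Rightarrow> nat \<Rightarrow> real) \<Rightarrow> (nat \<Rightarrow> real) \<Rightarrow> bool" where
  "eigensystem n G u e \<longleftrightarrow>
     (\<forall>i<n. \<forall>j<n. (\<Sum>a<n. u i a * u j a) = of_bool (i = j)) \<and>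
     (\<forall>a<n. \<forall>b<n. (\<Sum>i<n. u i a * u i b) = of_bool (a = b)) \<and>
     (\<forall>a<n. \<forall>b<n. G a b = (\<Sum>i<n. e i * u i a * u i b)) \<and>
     (\<forall>i j. i \<le> j \<longrightarrow> j < n \<longrightarrow> e j \<le> e i)"

definition quad_form :: "nat \<Rightarrow> (nat \<Rightarrow> nat \<Rightarrow> real) \<Rightarrow> (nat \<Rightarrow> real) \<Rightarrow> real" where
  "quad_form n G x = (\<Sum>a<n. \<Sum>b<n. G a b * x a * x b)"

definition gram :: "real mat \<Rightarrow> nat \<Rightarrow> nat \<Rightarrow> real" where
  "gram B a b = (\<Sum>i<dim_row B. B $$ (i, a) * B $$ (i, b))"

text \<open>One interchange of sums serves three decompositions: Gram matrices (the rows of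
  \<open>B\<close> with weight 1), eigensystems, and the identity matrix, which gives
  Parseval.\<close>

lemma quad_form_sum_squares:
  assumes "\<And>a b. a < n \<Longrightarrow> b < n \<Longrightarrow> G a b = (\<Sum>i<p. e i * u i a * u i b)"
  shows "quad_form n G x = (\<Sum>i<p. e i * (\<Sum>a<n. u i a * x a)\<^sup>2)"
proof -
  have "(\<Sum>i<p. e i * (\<Sum>a<n. u i a * x a)\<^sup>2) =
      (\<Sum>i<p. \<Sum>a<n. \<Sum>b<n. e i * u i a * u i b * x a * x b)"
    unfolding power2_eq_square sum_product unfolding sum_distrib_left
    by (intro sum.cong refl) (simp add: algebra_simps)
  also have "\<dots> = (\<Sum>a<n. \<Sum>i<p. \<Sum>b<n. e i * u i a * u i b * x a * x b)" by (rule sum.swap)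
  also have "\<dots> = (\<Sum>a<n. \<Sum>b<n. \<Sum>i<p. e i * u i a * u i b * x a * x b)"
    by (intro sum.cong refl sum.swap)
  finally show ?thesis unfolding quad_form_def by (simp add: assms sum_distrib_right)
qed

lemma quad_form_gram:
  "quad_form n (gram B) x = (\<Sum>i<dim_row B. (\<Sum>a<n. B $$ (i, a) * x a)\<^sup>2)"
  using quad_form_sum_squares[where G = "gram B" and p = "dim_row B" and e = "\<lambda>_. 1" and u = "\<lambda>i a. B $$ (i, a)"]
  by (simp add: gram_def)

lemma quad_form_eigensystem:
  assumes "eigensystem n G u e"
  shows "quad_form n G x = (\<Sum>i<n. e i * (\<Sum>a<n. u i a * x a)\<^sup>2)"
  using assms by (intro quad_form_sum_squares) (auto simp: eigensystem_def)

lemma eigensystem_parseval: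
  assumes "eigensystem n G u e"
  shows "(\<Sum>a<n. (x a)\<^sup>2) = (\<Sum>i<n. (\<Sum>a<n. u i a * x a)\<^sup>2)"
proof -
  have "quad_form n (\<lambda>a b. of_bool (a = b)) x = (\<Sum>i<n. 1 * (\<Sum>a<n. u i a * x a)\<^sup>2)"
    using assms by (intro quad_form_sum_squares) (auto simp: eigensystem_def)
  moreover have "quad_form n (\<lambda>a b. of_bool (a = b)) x = (\<Sum>a<n. (x a)\<^sup>2)"
    unfolding quad_form_def
    by (intro sum.cong refl) (auto simp: of_bool_def if_distrib if_distribR power2_eq_square sum.delta cong: if_cong)
  ultimately show ?thesis by simp
qed

lemma eigensystem_trace:
  assumes "eigensystem n G u e"
  shows "(\<Sum>a<n. G a a) = (\<Sum>i<n. e i)"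
proof -
  have "(\<Sum>a<n. G a a) = (\<Sum>a<n. \<Sum>i<n. e i * u i a * u i a)"
    using assms by (auto simp: eigensystem_def)
  also have "\<dots> = (\<Sum>i<n. \<Sum>a<n. e i * u i a * u i a)" by (rule sum.swap)
  also have "\<dots> = (\<Sum>i<n. e i * (\<Sum>a<n. u i a * u i a))" by (simp add: sum_distrib_left mult.assoc)
  also have "\<dots> = (\<Sum>i<n. e i)" using assms by (auto simp: eigensystem_def)
  finally show ?thesis .
qed

lemma eigensystem_eigenvalue:
  assumes "eigensystem n G u e" "i < n"
  shows "quad_form n G (u i) = e i"
proof -
  have "quad_form n G (u i) = (\<Sum>j<n. if j = i then e j else 0)"
    unfolding quad_form_eigensystem[OF assms(1)]
    using assms by (intro sum.cong refl) (auto simp: eigensystem_def)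
  then show ?thesis using assms(2) by simp
qed

lemma eigensystem_gram_nonneg:
  assumes "eigensystem n (gram B) u e" "i < n"
  shows "e i \<ge> 0"
  unfolding eigensystem_eigenvalue[OF assms, symmetric] quad_form_gram by (intro sum_nonneg) auto

lemma eigensystem_scale:
  assumes "eigensystem n G u e" "c \<ge> 0"
  shows "eigensystem n (\<lambda>a b. c * G a b) u (\<lambda>i. c * e i)"
  using assms by (auto simp: eigensystem_def sum_distrib_left mult.assoc intro!: mult_left_mono)

text \<open>Padding the \<open>N\<close> equations with a zero row gives a square matrix of
  determinant 0, whose kernel supplies \<open>z\<close>.\<close>

lemma underdetermined_system:
  fixes c :: "nat \<Rightarrow> nat \<Rightarrow> real"
  obtains z j where "j < Suc N" "z j \<noteq> 0" "\<And>k. k < N \<Longrightarrow> (\<Sum>j<Suc N. c k j * z j) = 0"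
proof -
  define A where "A = mat (Suc N) (Suc N) (\<lambda>(i, j). if i < N then c i j else 0)"
  have A: "A \<in> carrier_mat (Suc N) (Suc N)" by (simp add: A_def)
  have "det A = 0"
    using laplace_expansion_row[OF A, of N] by (simp add: A_def)
  then obtain v where v: "v \<in> carrier_vec (Suc N)" "v \<noteq> 0\<^sub>v (Suc N)" "A *\<^sub>v v = 0\<^sub>v (Suc N)"
    using det_0_iff_vec_prod_zero_field[OF A] by auto
  obtain j where "j < Suc N" "v $ j \<noteq> 0"
    using v by (metis carrier_vecD eq_vecI index_zero_vec)
  moreover have "(\<Sum>j<Suc N. c k j * v $ j) = 0" if "k < N" for k
    using arg_cong[OF v(3), of "\<lambda>w. w $ k"] that v(1)
    by (simp add: A_def scalar_prod_def atLeast0LessThan)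
  ultimately show thesis using that[of j "\<lambda>j. v $ j"] by blast
qed

text \<open>Among the combinations of the first \<open>i + r + 1\<close> eigenvectors of \<open>G\<close> there is one orthogonal to
  the \<open>r\<close> vectors \<open>b\<close> and to the first \<open>i\<close> eigenvectors of \<open>H\<close>.\<close>

lemma eigenvalue_comparison:
  assumes G: "eigensystem n G u e" and H: "eigensystem n H w f" and ir: "i + r < n"
    and le: "\<And>x. (\<And>l. l < r \<Longrightarrow> (\<Sum>a<n. b l a * x a) = 0) \<Longrightarrow>
      quad_form n G x \<le> quad_form n H x + \<delta> * (\<Sum>a<n. (x a)\<^sup>2)"
  shows "e (i + r) \<le> f i + \<delta>"
proof -
  let ?N = "i + r"
  \<comment> \<open>The vectors \<open>b\<close> and the first \<open>i\<close> eigenvectors of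
    \<open>H\<close> are numbered consecutively: \<open>i + r\<close> equations for
    \<open>i + r + 1\<close> coefficients.\<close>
  define g where "g k = (if k < r then b k else w (k - r))" for k
  obtain z j0 where z: "j0 < Suc ?N" "z j0 \<noteq> 0"
    "\<And>k. k < ?N \<Longrightarrow> (\<Sum>j<Suc ?N. (\<Sum>a<n. g k a * u j a) * z j) = 0"
    by (rule underdetermined_system[of ?N "\<lambda>k j. \<Sum>a<n. g k a * u j a"]) (rule that)
  define x where "x a = (\<Sum>j<Suc ?N. z j * u j a)" for a
  have ip: "(\<Sum>a<n. h a * x a) = (\<Sum>j<Suc ?N. (\<Sum>a<n. h a * u j a) * z j)" for h
    unfolding x_def sum_distrib_left sum_distrib_right
    by (subst sum.swap) (simp add: algebra_simps del: sum.lessThan_Suc)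
  have orth: "(\<Sum>a<n. g k a * x a) = 0" if "k < ?N" for k
    unfolding ip by (rule z(3)[OF that])
  have b0: "(\<Sum>a<n. b l a * x a) = 0" if "l < r" for l
    using orth[of l] that by (simp add: g_def)
  have w0: "(\<Sum>a<n. w k a * x a) = 0" if "k < i" for k
    using orth[of "k + r"] that by (simp add: g_def)
  have ux: "(\<Sum>a<n. u k a * x a) = (if k < Suc ?N then z k else 0)" if "k < n" for k
  proof -
    have "(\<Sum>a<n. u k a * x a) = (\<Sum>j<Suc ?N. if j = k then z j else 0)"
      unfolding ip using that ir G by (intro sum.cong refl) (auto simp: eigensystem_def)
    then show ?thesis by (simp del: sum.lessThan_Suc)
  qed
  let ?X = "\<Sum>a<n. (x a)\<^sup>2"
  have "(z j0)\<^sup>2 \<le> (\<Sum>k<n. (\<Sum>a<n. u k a * x a)\<^sup>2)"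
    using z(1) ir ux[of j0] by (intro order_trans[OF _ member_le_sum[of j0]]) auto
  then have X: "?X > 0"
    using z(2) eigensystem_parseval[OF G, of x] by (simp add: less_le_trans[of 0 "(z j0)\<^sup>2"])
  \<comment> \<open>The coefficients of \<open>x\<close> beyond \<open>?N\<close> vanish and
    \<open>e\<close> decreases, so the form of \<open>G\<close> is at least
    \<open>e ?N * ?X\<close>. Orthogonality to the first \<open>i\<close> eigenvectors of
    \<open>H\<close> bounds the form of \<open>H\<close> by \<open>f i * ?X\<close>.\<close>
  have "e ?N * ?X = (\<Sum>k<n. e ?N * (\<Sum>a<n. u k a * x a)\<^sup>2)"
    unfolding eigensystem_parseval[OF G, of x] sum_distrib_left ..
  also have "\<dots> \<le> (\<Sum>k<n. e k * (\<Sum>a<n. u k a * x a)\<^sup>2)"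
  proof (rule sum_mono)
    fix k assume "k \<in> {..<n}"
    then show "e ?N * (\<Sum>a<n. u k a * x a)\<^sup>2 \<le> e k * (\<Sum>a<n. u k a * x a)\<^sup>2"
      using G ir ux[of k] by (cases "k \<le> ?N") (auto simp: eigensystem_def intro!: mult_right_mono)
  qed
  also have "\<dots> = quad_form n G x" by (rule quad_form_eigensystem[OF G, symmetric])
  also have "\<dots> \<le> quad_form n H x + \<delta> * ?X" by (rule le[OF b0])
  also have "quad_form n H x = (\<Sum>k<n. f k * (\<Sum>a<n. w k a * x a)\<^sup>2)"
    by (rule quad_form_eigensystem[OF H])
  also have "\<dots> \<le> (\<Sum>k<n. f i * (\<Sum>a<n. w k a * x a)\<^sup>2)"
  proof (rule sum_mono)
    fix k assume "k \<in> {..<n}"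
    then show "f k * (\<Sum>a<n. w k a * x a)\<^sup>2 \<le> f i * (\<Sum>a<n. w k a * x a)\<^sup>2"
      using H w0[of k] by (cases "k < i") (auto simp: eigensystem_def intro!: mult_right_mono)
  qed
  also have "\<dots> = f i * ?X"
    unfolding eigensystem_parseval[OF H, of x] sum_distrib_left ..
  finally have "e ?N * ?X \<le> (f i + \<delta>) * ?X" by (simp add: algebra_simps)
  then show ?thesis using X by simp
qed

text \<open>Cauchy-Schwarz over the pairs (a, b): the Frobenius norm of \<open>D\<close> bounds its
  quadratic form on unit vectors.\<close>

lemma abs_quad_form_le:
  "\<bar>quad_form n D x\<bar> \<le> sqrt (\<Sum>a<n. \<Sum>b<n. (D a b)\<^sup>2) * (\<Sum>a<n. (x a)\<^sup>2)"
proof -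
  let ?I = "{..<n} \<times> {..<n}"
  have "(quad_form n D x)\<^sup>2 = (\<Sum>ab\<in>?I. D (fst ab) (snd ab) * (x (fst ab) * x (snd ab)))\<^sup>2"
    unfolding quad_form_def by (simp add: sum.cartesian_product case_prod_unfold mult.assoc)
  also have "\<dots> \<le> (\<Sum>ab\<in>?I. (D (fst ab) (snd ab))\<^sup>2) * (\<Sum>ab\<in>?I. (x (fst ab) * x (snd ab))\<^sup>2)"
    by (rule Cauchy_Schwarz_ineq_sum)
  also have "(\<Sum>ab\<in>?I. (D (fst ab) (snd ab))\<^sup>2) = (\<Sum>a<n. \<Sum>b<n. (D a b)\<^sup>2)"
    by (simp add: sum.cartesian_product case_prod_unfold)
  also have "(\<Sum>ab\<in>?I. (x (fst ab) * x (snd ab))\<^sup>2) = (\<Sum>a<n. (x a)\<^sup>2)\<^sup>2"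
    unfolding power2_eq_square[of "\<Sum>a<n. (x a)\<^sup>2"] sum_product
    by (simp add: sum.cartesian_product case_prod_unfold power_mult_distrib)
  finally have "sqrt ((quad_form n D x)\<^sup>2) \<le> sqrt ((\<Sum>a<n. \<Sum>b<n. (D a b)\<^sup>2) * (\<Sum>a<n. (x a)\<^sup>2)\<^sup>2)"
    by (rule real_sqrt_le_mono)
  then show ?thesis by (simp add: real_sqrt_mult sum_nonneg)
qed

text \<open>Two comparisons with \<open>r = 0\<close>, in opposite directions, with the Frobenius
  norm of the difference as \<open>\<delta>\<close>.\<close>

lemma weyl_perturbation:
  assumes G: "eigensystem n G u e" and H: "eigensystem n H w f" and i: "i < n"
  shows "\<bar>e i - f i\<bar> \<le> sqrt (\<Sum>a<n. \<Sum>b<n. (G a b - H a b)\<^sup>2)"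
proof -
  let ?\<delta> = "sqrt (\<Sum>a<n. \<Sum>b<n. (G a b - H a b)\<^sup>2)"
  have diff: "quad_form n G x - quad_form n H x = quad_form n (\<lambda>a b. G a b - H a b) x" for x
    by (simp add: quad_form_def sum_subtractf left_diff_distrib)
  have "\<bar>quad_form n G x - quad_form n H x\<bar> \<le> ?\<delta> * (\<Sum>a<n. (x a)\<^sup>2)" for x
    unfolding diff by (rule abs_quad_form_le)
  then have "quad_form n G x \<le> quad_form n H x + ?\<delta> * (\<Sum>a<n. (x a)\<^sup>2)"
    "quad_form n H x \<le> quad_form n G x + ?\<delta> * (\<Sum>a<n. (x a)\<^sup>2)" for x
    by (simp_all add: abs_le_iff algebra_simps)
  then have "e i \<le> f i + ?\<delta>" "f i \<le> e i + ?\<delta>"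
    using eigenvalue_comparison[OF G H, of i 0] eigenvalue_comparison[OF H G, of i 0] i by auto
  then show ?thesis by simp
qed

section \<open>Singular values from the Gram matrix\<close>

text \<open>The spectral theorem yields the eigenvectors in arbitrary order, and the permutation
  \<open>p\<close> sorts them. The characteristic polynomial, computed from the diagonal form,
  identifies the eigenvalues with those behind \<open>singular_values\<close>.\<close>

lemma gram_eigensystem:
  fixes B :: "real mat"
  obtains u e where "eigensystem (dim_col B) (gram B) u e"
    "singular_values B = map (\<lambda>i. sqrt (e i)) [0..<dim_col B]"
proof -
  let ?n = "dim_col B"
  let ?G = "transpose_mat B * B"
  have G: "?G \<in> carrier_mat ?n ?n" by (rule mult_carrier_mat[of _ _ "dim_row B"]) auto
  have "transpose_mat ?G = ?G" by (subst transpose_mult[of _ ?n "dim_row B" _ ?n]) auto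
  from real_spectral_theorem[OF G this] obtain U d where U: "U \<in> carrier_mat ?n ?n"
    "U * transpose_mat U = 1\<^sub>m ?n" "transpose_mat U * U = 1\<^sub>m ?n"
    "?G = U * diag_of ?n d * transpose_mat U" by blast
  define ds where "ds = map d [0..<?n]"
  have "similar_mat ?G (diag_of ?n d)"
    using U by (intro similar_matI[of _ _ U "transpose_mat U" ?n]) auto
  then have "char_poly ?G = char_poly (diag_of ?n d)" by (rule char_poly_similar)
  also have "\<dots> = (\<Prod>a\<leftarrow>ds. [:- a, 1:])"
    by (subst char_poly_upper_triangular[of _ ?n])
      (auto simp: diag_of_def diag_mat_def ds_def intro!: arg_cong[of _ _ prod_list] map_cong)
  finally have char_poly: "char_poly ?G = (\<Prod>a\<leftarrow>ds. [:- a, 1:])" .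
  have "proots (char_poly ?G) = mset ds" unfolding char_poly
    by (induction ds) (simp_all add: proots_mult prod_list_zero_iff image_iff del: mult_pCons_left)
  then have sv: "singular_values B = rev (sort (map sqrt ds))"
    unfolding singular_values_def by (simp flip: mset_map)
  define es where "es = rev (sort ds)"
  have "mset es = mset ds" by (simp add: es_def)
  then obtain p where p: "p permutes {..<length ds}" "permute_list p ds = es"
    by (rule mset_eq_permutation)
  have len: "length ds = ?n" "length es = ?n" by (auto simp: ds_def es_def)
  have pb: "bij_betw p {..<?n} {..<?n}" using p(1) len by (simp add: permutes_imp_bij)
  have plt: "p i < ?n" if "i < ?n" for i using pb that by (auto simp: bij_betw_def)
  have inj: "p i = p j \<longleftrightarrow> i = j" for i j using p(1) by (auto dest: permutes_inj injD)
  have es: "es ! i = d (p i)" if "i < ?n" for i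
    using permute_list_nth[OF p(1)] that len plt p(2) by (simp add: ds_def)
  \<comment> \<open>\<open>sqrt\<close> is monotone on all reals, so it commutes with
    sorting.\<close>
  have "sort (map sqrt ds) = map sqrt (sort ds)"
    by (rule properties_for_sort) (auto intro!: sorted_map_mono mono_onI)
  then have "singular_values B = map sqrt es" using sv by (simp add: es_def rev_map)
  also have "\<dots> = map (\<lambda>i. sqrt (d (p i))) [0..<?n]"
    by (rule nth_equalityI) (auto simp: len es)
  finally have sv': "singular_values B = map (\<lambda>i. sqrt (d (p i))) [0..<?n]" .
  define u where "u i a = U $$ (a, p i)" for i a
  have "(\<Sum>a<?n. u i a * u j a) = of_bool (i = j)" if "i < ?n" "j < ?n" for i j
    using arg_cong[OF U(3), of "\<lambda>M. M $$ (p i, p j)"] U(1) plt that inj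
    by (simp add: u_def scalar_prod_def atLeast0LessThan)
  moreover have "(\<Sum>i<?n. u i a * u i b) = of_bool (a = b)" if "a < ?n" "b < ?n" for a b
    using arg_cong[OF U(2), of "\<lambda>M. M $$ (a, b)"] U(1) that
      sum.reindex_bij_betw[OF pb, of "\<lambda>i. U $$ (a, i) * U $$ (b, i)"]
    by (simp add: u_def scalar_prod_def atLeast0LessThan)
  moreover have "gram B a b = (\<Sum>i<?n. d (p i) * u i a * u i b)" if ab: "a < ?n" "b < ?n" for a b
  proof -
    have UD: "(U * diag_of ?n d) $$ (a, i) = d i * U $$ (a, i)" if "i < ?n" for i
      using U(1) ab that
      by (simp add: diag_of_def scalar_prod_def atLeast0LessThan if_distrib mult.commute cong: if_cong)
    have "gram B a b = ?G $$ (a, b)"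
      using ab by (simp add: gram_def scalar_prod_def atLeast0LessThan)
    also have "\<dots> = (\<Sum>i<?n. (U * diag_of ?n d) $$ (a, i) * U $$ (b, i))"
      unfolding U(4) using U(1) ab
      by (subst index_mult_mat(1)) (auto simp: scalar_prod_def atLeast0LessThan carrier_matD[OF diag_of_carrier] simp del: index_mult_mat(1))
    also have "\<dots> = (\<Sum>i<?n. d i * U $$ (a, i) * U $$ (b, i))" using UD by simp
    also have "\<dots> = (\<Sum>i<?n. d (p i) * u i a * u i b)"
      unfolding u_def by (rule sum.reindex_bij_betw[OF pb, symmetric])
    finally show ?thesis .
  qed
  moreover have "d (p j) \<le> d (p i)" if "i \<le> j" "j < ?n" for i j
  proof -
    have "sorted (rev es)" by (simp add: es_def)
    then have "es ! j \<le> es ! i" using that len unfolding sorted_rev_iff_nth_mono by auto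
    then show ?thesis using es that by simp
  qed
  ultimately have "eigensystem ?n (gram B) u (\<lambda>i. d (p i))" unfolding eigensystem_def by blast
  then show thesis using sv' by (rule that)
qed

section \<open>Low-rank approximation\<close>

lemma frobenius_norm_sq_gram: "(frobenius_norm B)\<^sup>2 = (\<Sum>a<dim_col B. gram B a a)"
proof -
  have "(frobenius_norm B)\<^sup>2 = (\<Sum>i<dim_row B. \<Sum>j<dim_col B. (B $$ (i, j))\<^sup>2)"
    unfolding frobenius_norm_def by (simp add: sum_nonneg)
  also have "\<dots> = (\<Sum>j<dim_col B. \<Sum>i<dim_row B. (B $$ (i, j))\<^sup>2)" by (rule sum.swap)
  finally show ?thesis by (simp add: gram_def power2_eq_square)
qed

text \<open>On vectors orthogonal to all \<open>v l\<close> the matrix \<open>B\<close> and the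
  residual \<open>E\<close> have the same quadratic form. Comparison with these \<open>r\<close>
  constraints gives \<open>e (i + r) \<le> f i\<close>, and the sum of all \<open>f i\<close> is the
  trace of the Gram matrix of \<open>E\<close>, its squared Frobenius norm.\<close>

lemma low_rank_approximation_ge:
  assumes B: "eigensystem (dim_col B) (gram B) u e"
  shows "(\<Sum>i\<in>{r..<dim_col B}. e i) \<le> (frobenius_norm (B - sum_outer (dim_row B) (dim_col B) r a v))\<^sup>2"
proof -
  let ?p = "dim_row B" and ?q = "dim_col B"
  define E where "E = B - sum_outer ?p ?q r a v"
  have dim: "dim_row E = ?p" "dim_col E = ?q" by (simp_all add: E_def sum_outer_def)
  obtain w f where E: "eigensystem ?q (gram E) w f" using gram_eigensystem[of E] dim by metis
  have le: "quad_form ?q (gram B) x \<le> quad_form ?q (gram E) x + 0 * (\<Sum>j<?q. (x j)\<^sup>2)"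
    if x: "\<And>l. l < r \<Longrightarrow> (\<Sum>j<?q. v l $ j * x j) = 0" for x
  proof -
    have "(\<Sum>j<?q. E $$ (i, j) * x j) = (\<Sum>j<?q. B $$ (i, j) * x j)" if i: "i < ?p" for i
    proof -
      have "(\<Sum>j<?q. (\<Sum>l<r. a l $ i * v l $ j) * x j) = (\<Sum>l<r. \<Sum>j<?q. a l $ i * (v l $ j * x j))"
        unfolding sum_distrib_right by (subst sum.swap) (simp add: mult.assoc)
      also have "\<dots> = 0" using x by (simp flip: sum_distrib_left)
      finally show ?thesis
        using i by (simp add: E_def sum_outer_def left_diff_distrib sum_subtractf)
    qed
    then show ?thesis unfolding quad_form_gram dim by simp
  qed
  have cmp: "e (i + r) \<le> f i" if "i + r < ?q" for i
    using eigenvalue_comparison[OF B E that, where b = "\<lambda>l j. v l $ j" and \<delta> = 0] le by simp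
  have f0: "f i \<ge> 0" if "i < ?q" for i using eigensystem_gram_nonneg[OF E that] .
  \<comment> \<open>For \<open>r \<ge> ?q\<close> both sums are empty, the subtraction being
    truncated.\<close>
  have "(\<Sum>i\<in>{r..<?q}. e i) = (\<Sum>i<?q - r. e (i + r))"
    by (rule sum.reindex_bij_witness[of _ "\<lambda>i. i + r" "\<lambda>i. i - r"]) auto
  also have "\<dots> \<le> (\<Sum>i<?q - r. f i)"
    using cmp by (intro sum_mono) auto
  also have "\<dots> \<le> (\<Sum>i<?q. f i)" using f0 by (intro sum_mono2) auto
  also have "\<dots> = (frobenius_norm E)\<^sup>2"
    using eigensystem_trace[OF E] dim by (simp add: frobenius_norm_sq_gram)
  finally show ?thesis by (simp add: E_def)
qed

text \<open>The truncated singular value decomposition, with the singular value absorbed into the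
  left factor B u_l.\<close>

lemma low_rank_approximation_attained:
  assumes B: "eigensystem (dim_col B) (gram B) u e"
  obtains a v where "\<And>l. l < r \<Longrightarrow> a l \<in> carrier_vec (dim_row B)" "\<And>l. l < r \<Longrightarrow> v l \<in> carrier_vec (dim_col B)"
    "(frobenius_norm (B - sum_outer (dim_row B) (dim_col B) r a v))\<^sup>2 = (\<Sum>i\<in>{r..<dim_col B}. e i)"
proof -
  let ?p = "dim_row B" and ?q = "dim_col B"
  \<comment> \<open>The value 0 for \<open>l \<ge> ?q\<close> allows more terms than columns: the
    surplus ones vanish.\<close>
  define y where "y l i = (if l < ?q then \<Sum>b<?q. B $$ (i, b) * u l b else 0)" for l i
  define a where "a l = vec ?p (y l)" for l
  define v where "v l = vec ?q (u l)" for l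
  define E where "E = B - sum_outer ?p ?q r a v"
  have dim: "dim_row E = ?p" "dim_col E = ?q" by (simp_all add: E_def sum_outer_def)
  have ysq: "(\<Sum>i<?p. (y l i)\<^sup>2) = e l" if "l < ?q" for l
    using eigensystem_eigenvalue[OF B that] that by (simp add: quad_form_gram y_def)
  \<comment> \<open>Completeness of the \<open>u l\<close> expands each row of \<open>B\<close> in
    this basis.\<close>
  have Bexp: "B $$ (i, j) = (\<Sum>l<?q. y l i * u l j)" if "i < ?p" "j < ?q" for i j
  proof -
    have "(\<Sum>l<?q. y l i * u l j) = (\<Sum>b<?q. \<Sum>l<?q. B $$ (i, b) * (u l b * u l j))"
      by (subst sum.swap) (simp add: y_def sum_distrib_right mult.assoc)
    also have "\<dots> = (\<Sum>b<?q. B $$ (i, b) * of_bool (b = j))"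
      using B that by (auto simp: eigensystem_def simp flip: sum_distrib_left)
    also have "\<dots> = (\<Sum>b<?q. if b = j then B $$ (i, b) else 0)" by (intro sum.cong) auto
    finally show ?thesis using that by simp
  qed
  have Eexp: "E $$ (i, j) = (\<Sum>l<?q. (if l < r then 0 else y l i) * u l j)" if "i < ?p" "j < ?q" for i j
  proof -
    have "(\<Sum>l<r. y l i * u l j) = (\<Sum>l\<in>{..<r} \<inter> {..<?q}. y l i * u l j)"
      by (rule sum.mono_neutral_right) (auto simp: y_def)
    also have "\<dots> = (\<Sum>l<?q. if l \<in> {..<r} then y l i * u l j else 0)"
      by (subst sum.inter_restrict[symmetric]) (auto simp: Int_commute)
    finally have "E $$ (i, j) = (\<Sum>l<?q. y l i * u l j) - (\<Sum>l<?q. if l \<in> {..<r} then y l i * u l j else 0)"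
      using that Bexp by (simp add: E_def sum_outer_def a_def v_def)
    also have "\<dots> = (\<Sum>l<?q. (if l < r then 0 else y l i) * u l j)"
      unfolding sum_subtractf[symmetric] by (intro sum.cong) auto
    finally show ?thesis .
  qed
  \<comment> \<open>Parseval: by orthonormality the \<open>c l\<close> are the coordinates of the
    combination.\<close>
  have row: "(\<Sum>j<?q. (\<Sum>l<?q. c l * u l j)\<^sup>2) = (\<Sum>l<?q. (c l)\<^sup>2)" for c
  proof -
    have "(\<Sum>j<?q. u i j * (\<Sum>l<?q. c l * u l j)) = c i" if i: "i < ?q" for i
    proof -
      have "(\<Sum>j<?q. u i j * (\<Sum>l<?q. c l * u l j)) = (\<Sum>l<?q. c l * (\<Sum>j<?q. u i j * u l j))"
        unfolding sum_distrib_left by (subst sum.swap) (simp add: algebra_simps)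
      also have "\<dots> = (\<Sum>l<?q. if l = i then c l else 0)"
        using B i by (intro sum.cong) (auto simp: eigensystem_def)
      finally show ?thesis using i by simp
    qed
    then show ?thesis
      using eigensystem_parseval[OF B, of "\<lambda>j. \<Sum>l<?q. c l * u l j"] by simp
  qed
  have "(frobenius_norm E)\<^sup>2 = (\<Sum>i<?p. \<Sum>j<?q. (E $$ (i, j))\<^sup>2)"
    unfolding frobenius_norm_def dim by (simp add: sum_nonneg)
  also have "\<dots> = (\<Sum>i<?p. \<Sum>j<?q. (\<Sum>l<?q. (if l < r then 0 else y l i) * u l j)\<^sup>2)"
    using Eexp by simp
  also have "\<dots> = (\<Sum>i<?p. \<Sum>l<?q. (if l < r then 0 else y l i)\<^sup>2)"
    by (simp only: row)
  also have "\<dots> = (\<Sum>l<?q. \<Sum>i<?p. (if l < r then 0 else y l i)\<^sup>2)" by (rule sum.swap)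
  also have "\<dots> = (\<Sum>l<?q. if l \<in> {r..<?q} then e l else 0)"
    using ysq by (intro sum.cong) auto
  also have "\<dots> = (\<Sum>l\<in>{..<?q} \<inter> {r..<?q}. e l)" by (rule sum.inter_restrict[symmetric]) simp
  also have "{..<?q} \<inter> {r..<?q} = {r..<?q}" by auto
  finally show thesis using that[of a v] by (simp add: a_def v_def E_def)
qed

text \<open>The lower bound holds for all factors and the truncated decomposition reaches it, so the
  infimum is a minimum.\<close>

theorem eckart_young:
  assumes B: "eigensystem (dim_col B) (gram B) u e"
  shows "low_rank_error r B = (\<Sum>i\<in>{r..<dim_col B}. e i)"
proof -
  obtain a v where av: "\<And>l. l < r \<Longrightarrow> a l \<in> carrier_vec (dim_row B)" "\<And>l. l < r \<Longrightarrow> v l \<in> carrier_vec (dim_col B)"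
    "(frobenius_norm (B - sum_outer (dim_row B) (dim_col B) r a v))\<^sup>2 = (\<Sum>i\<in>{r..<dim_col B}. e i)"
    using low_rank_approximation_attained[OF B, where r = r] by blast
  show ?thesis unfolding low_rank_error_def
  proof (rule cInf_eq_minimum)
    show "(\<Sum>i\<in>{r..<dim_col B}. e i) \<in>
      {(frobenius_norm (B - sum_outer (dim_row B) (dim_col B) r u v))\<^sup>2 | u v.
        (\<forall>l<r. u l \<in> carrier_vec (dim_row B)) \<and> (\<forall>l<r. v l \<in> carrier_vec (dim_col B))}"
      unfolding mem_Collect_eq by (rule exI[of _ a], rule exI[of _ v]) (use av in auto)
  qed (auto intro!: low_rank_approximation_ge[OF B])
qed

section \<open>Squared singular values as drops of the approximation error\<close>

text \<open>For \<open>t \<ge> 1\<close> this is the squared \<open>t\<close>-th singular value. In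
  this form invariance under transposition is easy to see, whereas \<open>singular_values\<close>
  treats rows and columns differently. Up to rescaling, the procedure computes it for the sampled
  submatrix.\<close>

definition error_drop :: "nat \<Rightarrow> real mat \<Rightarrow> real" where
  "error_drop t B = low_rank_error (t - 1) B - low_rank_error t B"

lemma error_drop_eq_eigenvalue:
  assumes B: "eigensystem (dim_col B) (gram B) u e" and t: "t \<ge> 1"
  shows "error_drop t B = (if t \<le> dim_col B then e (t - 1) else 0)"
proof (cases "t \<le> dim_col B")
  case True
  then have "{t - 1..<dim_col B} = insert (t - 1) {t..<dim_col B}" using t by auto
  then show ?thesis using True t unfolding error_drop_def eckart_young[OF B] by simp
qed (simp add: error_drop_def eckart_young[OF B])

lemma error_drop_nonneg:
  assumes "t \<ge> 1"
  shows "error_drop t B \<ge> 0"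
proof -
  obtain u e where B: "eigensystem (dim_col B) (gram B) u e" by (rule gram_eigensystem)
  show ?thesis
    using assms eigensystem_gram_nonneg[OF B, of "t - 1"] by (simp add: error_drop_eq_eigenvalue[OF B])
qed

lemma singular_value_error_drop:
  assumes t: "t \<ge> 1"
  shows "singular_value t B = sqrt (error_drop t B)"
proof -
  obtain u e where B: "eigensystem (dim_col B) (gram B) u e"
    and sv: "singular_values B = map (\<lambda>i. sqrt (e i)) [0..<dim_col B]" by (rule gram_eigensystem)
  show ?thesis
    using t unfolding error_drop_eq_eigenvalue[OF B t] singular_value_def sv by auto
qed

text \<open>Exchanging the factors \<open>u\<close> and \<open>v\<close> matches the approximants of
  the two matrices, with equal errors.\<close>

lemma low_rank_error_transpose: "low_rank_error r (transpose_mat B) = low_rank_error r B"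
proof -
  have eq: "frobenius_norm (transpose_mat B - sum_outer (dim_col B) (dim_row B) r v u) =
    frobenius_norm (B - sum_outer (dim_row B) (dim_col B) r u v)" for u v
    unfolding frobenius_norm_def
    by (subst (2) sum.swap) (simp add: sum_outer_def mult.commute)
  show ?thesis unfolding low_rank_error_def
    by (rule arg_cong[of _ _ Inf]) (auto simp: eq; blast)
qed

lemma error_drop_transpose: "error_drop t (transpose_mat B) = error_drop t B"
  by (simp add: error_drop_def low_rank_error_transpose)

text \<open>Weyl's inequality for rescaled Gram matrices. The numbers of rows may differ, so a
  matrix can be compared with a selection of its rows.\<close>

lemma error_drop_perturbation:
  assumes q: "dim_col A = q" "dim_col B = q" and t: "t \<ge> 1" and c: "c \<ge> 0" "c' \<ge> 0"
  shows "\<bar>c * error_drop t A - c' * error_drop t B\<bar> \<le>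
    sqrt (\<Sum>a<q. \<Sum>b<q. (c * gram A a b - c' * gram B a b)\<^sup>2)"
proof -
  obtain u e where A: "eigensystem (dim_col A) (gram A) u e" by (rule gram_eigensystem)
  obtain w f where B: "eigensystem (dim_col B) (gram B) w f" by (rule gram_eigensystem)
  show ?thesis
  proof (cases "t \<le> q")
    case True
    then show ?thesis
      using weyl_perturbation[OF eigensystem_scale[OF A c(1)] eigensystem_scale[OF B c(2), unfolded q, folded q(1)], of "t - 1"]
        t q by (simp add: error_drop_eq_eigenvalue[OF A] error_drop_eq_eigenvalue[OF B])
  next
    case False
    then show ?thesis using t q
      by (simp add: error_drop_eq_eigenvalue[OF A] error_drop_eq_eigenvalue[OF B] sum_nonneg)
  qed
qed

section \<open>Sampling rows\<close>

abbreviation bernoulli_family :: "nat \<Rightarrow> real \<Rightarrow> (nat \<Rightarrow> bool) pmf" where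
  "bernoulli_family n p \<equiv> Pi_pmf {..<n} False (\<lambda>_. bernoulli_pmf p)"

lemma integrable_bernoulli_family [simp]:
  "integrable (measure_pmf (bernoulli_family n p)) (f :: _ \<Rightarrow> real)"
proof (rule integrable_measure_pmf_finite)
  have "finite (PiE_dflt {..<n} False (set_pmf \<circ> (\<lambda>_. bernoulli_pmf p)))"
    by (rule finite_PiE_dflt) auto
  then show "finite (set_pmf (bernoulli_family n p))"
    by (rule finite_subset[OF set_Pi_pmf_subset', rotated]) simp
qed

lemma expectation_bernoulli_family_pair:
  assumes p: "0 \<le> p" "p \<le> 1" and ij: "i < n" "j < n"
  shows "measure_pmf.expectation (bernoulli_family n p) (\<lambda>f. of_bool (f i) * of_bool (f j)) =
    (if i = j then p else p\<^sup>2)"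
proof -
  \<comment> \<open>Factors 1 outside \<open>{i, j}\<close> turn the product of two indicators into
    one over all coordinates, to which independence applies. For \<open>i = j\<close> the set has
    one element, hence \<open>p\<close> instead of \<open>p\<^sup>2\<close>.\<close>
  define g :: "nat \<Rightarrow> bool \<Rightarrow> real" where "g x b = (if x \<in> {i, j} then of_bool b else 1)" for x b
  have restrict: "(\<Prod>x<n. if x \<in> {i, j} then h x else 1) = (\<Prod>x\<in>{i, j}. h x)" for h :: "nat \<Rightarrow> real"
  proof -
    have "(\<Prod>x<n. if x \<in> {i, j} then h x else 1) = (\<Prod>x\<in>{..<n} \<inter> {i, j}. h x)"
      by (rule prod.inter_restrict[symmetric]) simp
    also have "{..<n} \<inter> {i, j} = {i, j}" using ij by auto
    finally show ?thesis .
  qed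
  have "(\<Prod>x<n. g x (f x)) = of_bool (f i) * of_bool (f j)" for f
    unfolding g_def restrict by (cases "i = j") auto
  then have "measure_pmf.expectation (bernoulli_family n p) (\<lambda>f. of_bool (f i) * of_bool (f j)) =
      measure_pmf.expectation (bernoulli_family n p) (\<lambda>f. \<Prod>x<n. g x (f x))" by simp
  also have "\<dots> = (\<Prod>x<n. measure_pmf.expectation (bernoulli_pmf p) (g x))"
    by (rule expectation_prod_Pi_pmf) (auto simp: g_def intro: integrable_measure_pmf_finite)
  also have "\<dots> = (\<Prod>x<n. if x \<in> {i, j} then p else 1)"
    using p by (intro prod.cong refl) (simp add: g_def)
  finally show ?thesis unfolding restrict by (auto simp: power2_eq_square)
qed

lemma expectation_bernoulli_family_centred_pair:
  assumes p: "0 \<le> p" "p \<le> 1" and ij: "i < n" "j < n"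
  shows "measure_pmf.expectation (bernoulli_family n p) (\<lambda>f. (of_bool (f i) - p) * (of_bool (f j) - p)) =
    (if i = j then p - p\<^sup>2 else 0)"
proof -
  let ?E = "measure_pmf.expectation (bernoulli_family n p)"
  have E1: "?E (\<lambda>f. of_bool (f i)) = p" if "i < n" for i
  proof -
    have "(\<lambda>f. of_bool (f i) * of_bool (f i) :: real) = (\<lambda>f. of_bool (f i))" by auto
    then show ?thesis using expectation_bernoulli_family_pair[OF p that that] by simp
  qed
  have "?E (\<lambda>f. (of_bool (f i) - p) * (of_bool (f j) - p)) =
      ?E (\<lambda>f. of_bool (f i) * of_bool (f j) - p * of_bool (f i) - p * of_bool (f j) + p\<^sup>2)"
    by (rule arg_cong[where f = ?E]) (simp add: fun_eq_iff algebra_simps power2_eq_square)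
  also have "\<dots> = ?E (\<lambda>f. of_bool (f i) * of_bool (f j)) - p * ?E (\<lambda>f. of_bool (f i)) - p * ?E (\<lambda>f. of_bool (f j)) + p\<^sup>2"
    by (subst Bochner_Integration.integral_add, simp, simp, subst Bochner_Integration.integral_diff, simp, simp,
        subst Bochner_Integration.integral_diff, simp, simp) simp
  finally show ?thesis
    using expectation_bernoulli_family_pair[OF p ij] E1 ij by (auto simp: power2_eq_square)
qed

text \<open>Distinct centred indicators are uncorrelated, so only the diagonal of the double sum
  survives.\<close>

lemma variance_bernoulli_family_sum:
  assumes p: "0 \<le> p" "p \<le> 1"
  shows "measure_pmf.expectation (bernoulli_family n p) (\<lambda>f. (\<Sum>i<n. (of_bool (f i) - p) * y i)\<^sup>2) =
    (p - p\<^sup>2) * (\<Sum>i<n. (y i)\<^sup>2)"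
proof -
  let ?E = "measure_pmf.expectation (bernoulli_family n p)"
  have "?E (\<lambda>f. (\<Sum>i<n. (of_bool (f i) - p) * y i)\<^sup>2) =
      ?E (\<lambda>f. \<Sum>i<n. \<Sum>j<n. y i * y j * ((of_bool (f i) - p) * (of_bool (f j) - p)))"
    unfolding power2_eq_square sum_product by (simp add: algebra_simps)
  also have "\<dots> = (\<Sum>i<n. \<Sum>j<n. y i * y j * ?E (\<lambda>f. (of_bool (f i) - p) * (of_bool (f j) - p)))"
    by (simp add: Bochner_Integration.integral_sum)
  also have "\<dots> = (\<Sum>i<n. \<Sum>j<n. if j = i then (p - p\<^sup>2) * (y i)\<^sup>2 else 0)"
    using expectation_bernoulli_family_centred_pair[OF p]
    by (intro sum.cong refl) (auto simp: power2_eq_square algebra_simps)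
  finally show ?thesis by (simp add: sum_distrib_left)
qed

lemma set_pmf_random_subset: "S \<in> set_pmf (random_subset n p) \<Longrightarrow> S \<subseteq> {..<n}"
  by (auto simp: random_subset_def)

lemma integrable_random_subset [simp]:
  "integrable (measure_pmf (random_subset n p)) (f :: _ \<Rightarrow> real)"
proof (rule integrable_measure_pmf_finite)
  show "finite (set_pmf (random_subset n p))"
    by (rule finite_subset[of _ "Pow {..<n}"]) (auto dest: set_pmf_random_subset)
qed

lemma random_subset_second_moment:
  assumes p: "0 \<le> p" "p \<le> 1"
  shows "measure_pmf.expectation (random_subset n p) (\<lambda>S. (\<Sum>i<n. (of_bool (i \<in> S) - p) * y i)\<^sup>2) \<le>
    p * (\<Sum>i<n. (y i)\<^sup>2)"
proof -
  have "measure_pmf.expectation (random_subset n p) (\<lambda>S. (\<Sum>i<n. (of_bool (i \<in> S) - p) * y i)\<^sup>2) =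
      (p - p\<^sup>2) * (\<Sum>i<n. (y i)\<^sup>2)"
    using p variance_bernoulli_family_sum[OF p, of n y] by (simp add: random_subset_def min_def)
  also have "\<dots> \<le> p * (\<Sum>i<n. (y i)\<^sup>2)" by (intro mult_right_mono) (auto intro: sum_nonneg)
  finally show ?thesis .
qed

text \<open>The deterministic case, reached when \<open>k\<close> is at least the dimension.\<close>

lemma random_subset_1: "p \<ge> 1 \<Longrightarrow> random_subset n p = return_pmf {..<n}"
proof -
  assume "p \<ge> 1"
  then have "min 1 p = 1" by simp
  moreover have "bernoulli_pmf 1 = return_pmf True"
  proof (rule pmf_eqI)
    fix b show "pmf (bernoulli_pmf 1) b = pmf (return_pmf True) b" by (cases b) auto
  qed
  ultimately show ?thesis by (auto simp: random_subset_def intro!: arg_cong[of _ _ return_pmf])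
qed

section \<open>Concentration of the sampled Gram matrix\<close>

text \<open>Centring lowers the sum of squares by the squared sum over \<open>n\<close>. In the
  variance bound this replaces centred products of entries by the products themselves, at most L^2
  in absolute value.\<close>

lemma sum_centred_squares_le:
  fixes x :: "nat \<Rightarrow> real"
  assumes "n > 0"
  shows "(\<Sum>i<n. (x i - (\<Sum>j<n. x j) / n)\<^sup>2) \<le> (\<Sum>i<n. (x i)\<^sup>2)"
proof -
  define s where "s = (\<Sum>j<n. x j)"
  have "(\<Sum>i<n. (x i - s / n)\<^sup>2) = (\<Sum>i<n. (x i)\<^sup>2 - 2 * (s / n) * x i + (s / n)\<^sup>2)"
    by (intro sum.cong refl) (simp add: power2_diff)
  also have "\<dots> = (\<Sum>i<n. (x i)\<^sup>2) - 2 * (s / n) * s + n * (s / n)\<^sup>2"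
    unfolding sum.distrib sum_subtractf sum_distrib_left[symmetric] by (simp add: s_def)
  also have "\<dots> = (\<Sum>i<n. (x i)\<^sup>2) - s\<^sup>2 / n"
    using assms by (simp add: power2_eq_square field_simps)
  finally show ?thesis using assms by (simp add: s_def)
qed

text \<open>The rows indexed by \<open>S\<close> represent the Gram matrix of all rows of \<open>A\<close>, both normalised by the
  number of rows, up to a Frobenius error of \<open>sqrt \<delta> * m * L\<^sup>2\<close>.\<close>

definition good_sample :: "nat \<Rightarrow> nat \<Rightarrow> real \<Rightarrow> real \<Rightarrow> real \<Rightarrow> (nat \<Rightarrow> nat \<Rightarrow> real) \<Rightarrow> nat set \<Rightarrow> bool" where
  "good_sample n m L k \<delta> A S \<longleftrightarrow> S \<subseteq> {..<n} \<and> S \<noteq> {} \<and> real (card S) \<le> 2 * k \<and>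
     (\<Sum>a<m. \<Sum>b<m. (1 / n * (\<Sum>i<n. A i a * A i b) - 1 / card S * (\<Sum>i\<in>S. A i a * A i b))\<^sup>2)
       \<le> \<delta> * (real m)\<^sup>2 * L ^ 4"

text \<open>Two second-moment bounds, each failing with probability at most 1/12: one for the size
  of the sample, one for the squared deviations summed over all entries of the Gram matrix.\<close>

lemma prob_good_sample_proper:
  fixes k L :: real
  assumes k: "k \<ge> 48" "k < n" and L: "L > 0" and m: "m > 0" and \<delta>: "48 / k \<le> \<delta>"
    and bound: "\<And>i a. i < n \<Longrightarrow> a < m \<Longrightarrow> \<bar>A i a\<bar> \<le> L"
  shows "measure_pmf.prob (random_subset n (k / n)) {S. good_sample n m L k \<delta> A S} \<ge> 5 / 6"
proof -
  define p where "p = k / n"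
  let ?M = "random_subset n p"
  have n: "n > 0" using k by linarith
  have p: "0 \<le> p" "p \<le> 1" "p * n = k" using k n by (auto simp: p_def)
  define G where "G a b = (\<Sum>i<n. A i a * A i b) / n" for a b
  define c where "c S y = (\<Sum>i<n. (of_bool (i \<in> S) - p) * y i)" for S and y :: "nat \<Rightarrow> real"
  \<comment> \<open>Subtracting the mean \<open>G a b\<close> from each summand makes
    \<open>D S a b\<close> the sum over \<open>S\<close> minus \<open>card S * G a b\<close>, so
    that dividing by the random size \<open>card S\<close> adds no further error.\<close>
  define D where "D S a b = c S (\<lambda>i. A i a * A i b - G a b)" for S a b
  have c_eq: "c S y = (\<Sum>i\<in>S. y i) - p * (\<Sum>i<n. y i)" if "S \<subseteq> {..<n}" for S y
  proof -
    have "(\<Sum>i<n. of_bool (i \<in> S) * y i) = (\<Sum>i<n. if i \<in> S then y i else 0)"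
      by (intro sum.cong) auto
    also have "\<dots> = (\<Sum>i\<in>{..<n} \<inter> S. y i)" by (rule sum.inter_restrict[symmetric]) simp
    also have "{..<n} \<inter> S = S" using that by auto
    finally show ?thesis by (simp add: c_def left_diff_distrib sum_subtractf sum_distrib_left)
  qed
  \<comment> \<open>Chebyshev: the second moment is at most p n = k, so the bound is 4/k, which is
    at most 1/12 for \<open>k \<ge> 48\<close>.\<close>
  have size_bad: "measure_pmf.prob ?M {S. (c S (\<lambda>_. 1))\<^sup>2 \<ge> k\<^sup>2 / 4} \<le> 1 / 12"
  proof -
    have "measure_pmf.prob ?M {S. (c S (\<lambda>_. 1))\<^sup>2 \<ge> k\<^sup>2 / 4} \<le>
        measure_pmf.expectation ?M (\<lambda>S. (c S (\<lambda>_. 1))\<^sup>2) / (k\<^sup>2 / 4)"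
      using k integral_Markov_inequality_measure[of "measure_pmf ?M" "\<lambda>S. (c S (\<lambda>_. 1))\<^sup>2" "{}" "k\<^sup>2 / 4"]
      by simp
    also have "\<dots> \<le> k / (k\<^sup>2 / 4)"
      using random_subset_second_moment[OF p(1,2), of n "\<lambda>_. 1"] p(3)
      by (intro divide_right_mono) (auto simp: c_def)
    also have "\<dots> \<le> 1 / 12" using k by (simp add: field_simps power2_eq_square)
    finally show ?thesis .
  qed
  let ?F = "\<lambda>S. \<Sum>a<m. \<Sum>b<m. (D S a b)\<^sup>2"
  have exp_F: "measure_pmf.expectation ?M ?F \<le> k * (real m)\<^sup>2 * L ^ 4"
  proof -
    have "measure_pmf.expectation ?M ?F = (\<Sum>a<m. \<Sum>b<m. measure_pmf.expectation ?M (\<lambda>S. (D S a b)\<^sup>2))"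
      by (simp add: Bochner_Integration.integral_sum)
    also have "\<dots> \<le> (\<Sum>a<m. \<Sum>b<m. k * L ^ 4)"
    proof (intro sum_mono)
      fix a b assume ab: "a \<in> {..<m}" "b \<in> {..<m}"
      have "measure_pmf.expectation ?M (\<lambda>S. (D S a b)\<^sup>2) \<le> p * (\<Sum>i<n. (A i a * A i b - G a b)\<^sup>2)"
        unfolding D_def c_def by (rule random_subset_second_moment[OF p(1,2)])
      also have "\<dots> \<le> p * (\<Sum>i<n. (A i a * A i b)\<^sup>2)"
        unfolding G_def using p(1) n by (intro mult_left_mono sum_centred_squares_le) auto
      also have "\<dots> \<le> p * (\<Sum>i<n. L ^ 4)"
      proof (intro mult_left_mono sum_mono p(1))
        fix i assume i: "i \<in> {..<n}"
        have "\<bar>A i a * A i b\<bar> \<le> L * L"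
          unfolding abs_mult using bound i ab L by (intro mult_mono) auto
        then have "\<bar>A i a * A i b\<bar>\<^sup>2 \<le> (L * L)\<^sup>2" by (intro power_mono) auto
        then show "(A i a * A i b)\<^sup>2 \<le> L ^ 4" by (simp add: power2_eq_square power4_eq_xxxx mult.assoc)
      qed
      also have "\<dots> = k * L ^ 4" using p(3) by simp
      finally show "measure_pmf.expectation ?M (\<lambda>S. (D S a b)\<^sup>2) \<le> k * L ^ 4" .
    qed
    also have "\<dots> = k * (real m)\<^sup>2 * L ^ 4" by (simp add: power2_eq_square)
    finally show ?thesis .
  qed
  \<comment> \<open>The threshold is 12 times the bound on the expectation, so Markov's inequality
    gives 1/12.\<close>
  have T: "12 * k * (real m)\<^sup>2 * L ^ 4 > 0" using k L m by simp
  have gram_bad: "measure_pmf.prob ?M {S. ?F S \<ge> 12 * k * (real m)\<^sup>2 * L ^ 4} \<le> 1 / 12"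
  proof -
    have "measure_pmf.prob ?M {S. ?F S \<ge> 12 * k * (real m)\<^sup>2 * L ^ 4} \<le>
        measure_pmf.expectation ?M ?F / (12 * k * (real m)\<^sup>2 * L ^ 4)"
      using T integral_Markov_inequality_measure[of "measure_pmf ?M" ?F "{}" "12 * k * (real m)\<^sup>2 * L ^ 4"]
      by (simp add: sum_nonneg)
    also have "\<dots> \<le> (k * (real m)\<^sup>2 * L ^ 4) / (12 * k * (real m)\<^sup>2 * L ^ 4)"
      using T exp_F by (intro divide_right_mono) auto
    also have "\<dots> = 1 / 12" using k L m by simp
    finally show ?thesis .
  qed
  let ?good = "{S. good_sample n m L k \<delta> A S}"
  let ?bad = "{S. (c S (\<lambda>_. 1))\<^sup>2 \<ge> k\<^sup>2 / 4} \<union> {S. ?F S \<ge> 12 * k * (real m)\<^sup>2 * L ^ 4}"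
  have good: "S \<in> ?good" if S: "S \<subseteq> {..<n}" and "S \<notin> ?bad" for S
  proof -
    have c1: "c S (\<lambda>_. 1) = card S - k" using c_eq[OF S, of "\<lambda>_. 1"] p(3) by simp
    have "(c S (\<lambda>_. 1))\<^sup>2 < k\<^sup>2 / 4" and F: "?F S < 12 * k * (real m)\<^sup>2 * L ^ 4"
      using that(2) by simp_all
    then have "\<bar>card S - k\<bar>\<^sup>2 < (k / 2)\<^sup>2" unfolding c1 by (simp add: power_divide)
    then have "\<bar>card S - k\<bar> < k / 2" using k by (intro power2_less_imp_less[of _ "k / 2"]) auto
    then have card: "card S > k / 2" "card S \<le> 2 * k" by linarith+
    then have N: "card S > (0 :: real)" using k by linarith
    have D_eq: "1 / n * (\<Sum>i<n. A i a * A i b) - 1 / card S * (\<Sum>i\<in>S. A i a * A i b) = - D S a b / card S" for a b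
    proof -
      have "(\<Sum>i<n. A i a * A i b - G a b) = 0" using n by (simp add: G_def sum_subtractf)
      then have "D S a b = (\<Sum>i\<in>S. A i a * A i b) - card S * G a b"
        unfolding D_def c_eq[OF S] by (simp add: sum_subtractf)
      then have "- D S a b / card S = G a b - (\<Sum>i\<in>S. A i a * A i b) / card S"
        using N by (simp add: diff_divide_distrib)
      then show ?thesis by (simp add: G_def)
    qed
    have "(\<Sum>a<m. \<Sum>b<m. (1 / n * (\<Sum>i<n. A i a * A i b) - 1 / card S * (\<Sum>i\<in>S. A i a * A i b))\<^sup>2)
        = ?F S / (card S)\<^sup>2"
      unfolding D_eq by (simp add: power_divide sum_divide_distrib)
    \<comment> \<open>The sample has more than \<open>k / 2\<close> elements; this is where 48 = 12
      * 4 comes from.\<close>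
    also have "\<dots> \<le> (12 * k * (real m)\<^sup>2 * L ^ 4) / (k / 2)\<^sup>2"
      using F card k N by (intro frac_le power_mono) (auto simp: sum_nonneg)
    also have "\<dots> = 48 / k * ((real m)\<^sup>2 * L ^ 4)" using k by (simp add: power2_eq_square field_simps)
    also have "\<dots> \<le> \<delta> * ((real m)\<^sup>2 * L ^ 4)" using \<delta> by (intro mult_right_mono) auto
    finally show ?thesis using S card N by (auto simp: good_sample_def mult.assoc)
  qed
  have "measure_pmf.prob ?M ?bad \<le> 1 / 12 + 1 / 12"
    by (rule order_trans[OF measure_Un_le]) (use size_bad gram_bad in auto)
  then have "5 / 6 \<le> measure_pmf.prob ?M (- ?bad)"
    using measure_pmf.prob_compl[of ?bad ?M] by (simp add: Compl_eq_Diff_UNIV)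
  \<comment> \<open>Restricting to the support supplies \<open>S \<subseteq> {..<n}\<close>, which
    \<open>good\<close> requires.\<close>
  also have "\<dots> = measure_pmf.prob ?M (- ?bad \<inter> set_pmf ?M)" by (rule measure_Int_set_pmf[symmetric])
  also have "\<dots> \<le> measure_pmf.prob ?M ?good"
  proof (rule measure_pmf.finite_measure_mono)
    show "- ?bad \<inter> set_pmf ?M \<subseteq> ?good"
    proof
      fix S assume "S \<in> - ?bad \<inter> set_pmf ?M"
      then show "S \<in> ?good" by (intro good set_pmf_random_subset[of S n p]) simp_all
    qed
  qed simp
  finally show ?thesis by (simp add: p_def)
qed

text \<open>For \<open>n \<le> k\<close> every row is selected with certainty and the two normalised
  Gram matrices coincide.\<close>

lemma prob_good_sample:
  fixes k L :: real
  assumes n: "n > 0" and m: "m > 0" and L: "L > 0" and \<delta>: "0 \<le> \<delta>"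
    and k: "n \<le> k \<or> k \<ge> 48 \<and> 48 / k \<le> \<delta>"
    and bound: "\<And>i a. i < n \<Longrightarrow> a < m \<Longrightarrow> \<bar>A i a\<bar> \<le> L"
  shows "measure_pmf.prob (random_subset n (k / n)) {S. good_sample n m L k \<delta> A S} \<ge> 5 / 6"
proof (cases "n \<le> k")
  case True
  then have "random_subset n (k / n) = return_pmf {..<n}"
    using n by (intro random_subset_1) simp
  moreover have "good_sample n m L k \<delta> A {..<n}"
    using n True \<delta> by (auto simp: good_sample_def lessThan_empty_iff)
  ultimately show ?thesis by simp
next
  case False
  then show ?thesis using assms by (intro prob_good_sample_proper) auto
qed

text \<open>For sampling in two stages, where the second success event depends on the first outcome:
  integrate the bound \<open>b\<close> over \<open>S\<close>.\<close>

lemma prob_bind_pmf_ge: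
  assumes S: "measure_pmf.prob p S \<ge> a" and X: "\<And>x. x \<in> S \<Longrightarrow> measure_pmf.prob (f x) X \<ge> b"
    and b: "b \<ge> 0"
  shows "measure_pmf.prob (bind_pmf p f) X \<ge> a * b"
proof -
  have "ennreal (b * measure_pmf.prob p S) = (\<integral>\<^sup>+x. ennreal b * indicator S x \<partial>measure_pmf p)"
    using b by (simp add: ennreal_mult measure_pmf.emeasure_eq_measure nn_integral_cmult)
  also have "\<dots> \<le> (\<integral>\<^sup>+x. emeasure (measure_pmf (f x)) X \<partial>measure_pmf p)"
    using X by (intro nn_integral_mono) (auto simp: measure_pmf.emeasure_eq_measure ennreal_leI split: split_indicator)
  also have "\<dots> = ennreal (measure_pmf.prob (bind_pmf p f) X)"
    by (simp flip: measure_pmf.emeasure_eq_measure)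
  finally have "b * measure_pmf.prob p S \<le> measure_pmf.prob (bind_pmf p f) X"
    by (simp add: ennreal_le_iff)
  moreover have "a * b \<le> b * measure_pmf.prob p S" using mult_left_mono[OF S b] by (simp add: mult.commute)
  ultimately show ?thesis by linarith
qed

section \<open>The sampled matrix\<close>

text \<open>\<open>submatrix\<close> addresses its entries through \<open>pick\<close>; this turns
  sums over its indices into sums over the sample.\<close>

lemma bij_betw_pick:
  assumes "finite S"
  shows "bij_betw (pick S) {..<card S} S"
proof -
  have inj: "inj_on (pick S) {..<card S}"
    by (rule linorder_inj_onI') (use pick_mono_le[of _ S] in fastforce)
  moreover have "pick S ` {..<card S} \<subseteq> S" using pick_in_set_le by auto
  ultimately have "pick S ` {..<card S} = S"
    using assms by (intro card_subset_eq) (auto simp: card_image)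
  then show ?thesis using inj by (simp add: bij_betw_def)
qed

lemma sum_pick: "finite S \<Longrightarrow> (\<Sum>i<card S. f (pick S i)) = (\<Sum>i\<in>S. f i)"
  by (rule sum.reindex_bij_betw[OF bij_betw_pick])

text \<open>Subadditivity of \<open>sqrt\<close>. It turns an error bound for squared singular
  values into one for the values themselves.\<close>

lemma abs_sqrt_diff_le:
  assumes "x \<ge> 0" "y \<ge> 0"
  shows "\<bar>sqrt x - sqrt y\<bar> \<le> sqrt \<bar>x - y\<bar>"
proof -
  have *: "sqrt b - sqrt a \<le> sqrt (b - a)" if "0 \<le> a" "a \<le> b" for a b :: real
    using sqrt_add_le_add_sqrt[of a "b - a"] that by simp
  show ?thesis
  proof (cases "x \<le> y")
    case True
    then show ?thesis using *[of x y] assms by simp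
  next
    case False
    then show ?thesis using *[of y x] assms by simp
  qed
qed

text \<open>The passage from \<open>A\<close> to the submatrix goes through the matrix
  \<open>R SR\<close> of sampled rows. Its columns are sampled in turn, so the second stage is row
  sampling of its transpose.\<close>

lemma good_samples_estimate:
  fixes A :: "real mat" and L k \<delta> :: real
  defines "R SR \<equiv> mat (card SR) (dim_col A) (\<lambda>(i, j). A $$ (pick SR i, j))"
  assumes t: "t \<ge> 1" and nm: "dim_row A > 0" "dim_col A > 0" and \<delta>: "\<delta> \<ge> 0"
    and SR: "good_sample (dim_row A) (dim_col A) L k \<delta> (\<lambda>i a. A $$ (i, a)) SR"
    and SC: "good_sample (dim_col A) (card SR) L k \<delta> (\<lambda>j a. R SR $$ (a, j)) SC"
  shows "\<bar>error_drop t A - (Lambda_tilde A SR SC (t - 1) - Lambda_tilde A SR SC t)\<bar>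
     \<le> 2 * sqrt \<delta> * L\<^sup>2 * dim_row A * dim_col A"
    and "Lambda_tilde A SR SC (t - 1) - Lambda_tilde A SR SC t \<ge> 0"
proof -
  let ?n = "dim_row A" and ?m = "dim_col A"
  define N where "N = card SR"
  define M where "M = card SC"
  define B where "B = R SR"
  define B' where "B' = submatrix A SR SC"
  have sub: "SR \<subseteq> {..<?n}" "SC \<subseteq> {..<?m}" and ne: "SR \<noteq> {}" "SC \<noteq> {}"
    using SR SC by (auto simp: good_sample_def)
  then have fin: "finite SR" "finite SC" by (auto intro: finite_subset)
  then have pos: "N > 0" "M > 0" using ne by (auto simp: N_def M_def card_gt_0_iff)
  have "{i. i < ?n \<and> i \<in> SR} = SR" "{j. j < ?m \<and> j \<in> SC} = SC" using sub by auto
  then have B': "B' = mat N M (\<lambda>(i, j). A $$ (pick SR i, pick SC j))"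
    by (simp add: B'_def submatrix_def N_def M_def)
  have B: "B = mat N ?m (\<lambda>(i, j). A $$ (pick SR i, j))" by (simp add: B_def R_def N_def)
  have pickC: "pick SC j < ?m" if "j < M" for j
    using sub(2) pick_in_set_le[of j SC] that by (auto simp: M_def)
  have gB: "gram B a b = (\<Sum>i\<in>SR. A $$ (i, a) * A $$ (i, b))" if "a < ?m" "b < ?m" for a b
    using that sum_pick[OF fin(1), of "\<lambda>i. A $$ (i, a) * A $$ (i, b)"]
    by (simp add: gram_def B N_def)
  have gBT: "gram (transpose_mat B) a b = (\<Sum>j<?m. B $$ (a, j) * B $$ (b, j))" if "a < N" "b < N" for a b
    using that by (simp add: gram_def B)
  have gB'T: "gram (transpose_mat B') a b = (\<Sum>j\<in>SC. B $$ (a, j) * B $$ (b, j))" if "a < N" "b < N" for a b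
  proof -
    have "gram (transpose_mat B') a b = (\<Sum>j<M. B $$ (a, pick SC j) * B $$ (b, pick SC j))"
      using that pickC by (simp add: gram_def B B')
    then show ?thesis using sum_pick[OF fin(2), of "\<lambda>j. B $$ (a, j) * B $$ (b, j)"] by (simp add: M_def)
  qed
  have root: "sqrt (\<delta> * (real d)\<^sup>2 * L ^ 4) = sqrt \<delta> * d * L\<^sup>2" for d
  proof -
    have "L ^ 4 = (L\<^sup>2)\<^sup>2" by simp
    then show ?thesis by (simp only: real_sqrt_mult real_sqrt_abs) simp
  qed
  have rows: "\<bar>1 / ?n * error_drop t A - 1 / N * error_drop t B\<bar> \<le> sqrt \<delta> * ?m * L\<^sup>2"
  proof -
    have "(\<Sum>a<?m. \<Sum>b<?m. (1 / ?n * gram A a b - 1 / N * gram B a b)\<^sup>2) \<le> \<delta> * (real ?m)\<^sup>2 * L ^ 4"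
      using SR by (simp add: good_sample_def gB N_def) (simp add: gram_def)
    then have "sqrt (\<Sum>a<?m. \<Sum>b<?m. (1 / ?n * gram A a b - 1 / N * gram B a b)\<^sup>2)
        \<le> sqrt \<delta> * ?m * L\<^sup>2" unfolding root[symmetric] by (rule real_sqrt_le_mono)
    then show ?thesis
      by (rule order_trans[OF error_drop_perturbation, rotated -1]) (use t in \<open>auto simp: B\<close>)
  qed
  have "\<bar>1 / ?m * error_drop t (transpose_mat B) - 1 / M * error_drop t (transpose_mat B')\<bar> \<le> sqrt \<delta> * N * L\<^sup>2"
  proof -
    have "(\<Sum>a<N. \<Sum>b<N. (1 / ?m * gram (transpose_mat B) a b - 1 / M * gram (transpose_mat B') a b)\<^sup>2)
        \<le> \<delta> * (real N)\<^sup>2 * L ^ 4"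
      using SC[folded B_def N_def] by (simp add: good_sample_def gBT gB'T M_def)
    then have "sqrt (\<Sum>a<N. \<Sum>b<N. (1 / ?m * gram (transpose_mat B) a b - 1 / M * gram (transpose_mat B') a b)\<^sup>2)
        \<le> sqrt \<delta> * N * L\<^sup>2" unfolding root[symmetric] by (rule real_sqrt_le_mono)
    then show ?thesis
      by (rule order_trans[OF error_drop_perturbation, rotated -1]) (use t in \<open>auto simp: B B'\<close>)
  qed
  \<comment> \<open>Invariance under transposition joins the two stages.\<close>
  then have cols: "\<bar>1 / ?m * error_drop t B - 1 / M * error_drop t B'\<bar> \<le> sqrt \<delta> * N * L\<^sup>2"
    by (simp only: error_drop_transpose)
  define z where "z = Lambda_tilde A SR SC (t - 1) - Lambda_tilde A SR SC t"
  have z: "z = ?n * ?m / (real N * M) * error_drop t B'"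
    by (simp add: z_def Lambda_tilde_def error_drop_def B'_def N_def M_def right_diff_distrib)
  show "Lambda_tilde A SR SC (t - 1) - Lambda_tilde A SR SC t \<ge> 0"
    unfolding z_def[symmetric] z using error_drop_nonneg[OF t] by simp
  \<comment> \<open>Telescoping through \<open>B\<close>. After rescaling, the factor
    \<open>N\<close> of the column error cancels and each stage contributes sqrt \<delta> L^2 n
    m.\<close>
  have "error_drop t A - z = ?n * (1 / ?n * error_drop t A - 1 / N * error_drop t B)
      + ?n * ?m / N * (1 / ?m * error_drop t B - 1 / M * error_drop t B')"
    using nm pos by (simp add: z right_diff_distrib)
  also have "\<bar>\<dots>\<bar> \<le> ?n * (sqrt \<delta> * ?m * L\<^sup>2) + ?n * ?m / N * (sqrt \<delta> * N * L\<^sup>2)"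
    by (rule order_trans[OF abs_triangle_ineq], unfold abs_mult, intro add_mono mult_mono)
      (use rows cols in auto)
  also have "\<dots> = 2 * sqrt \<delta> * L\<^sup>2 * ?n * ?m" using pos by simp
  finally show "\<bar>error_drop t A - (Lambda_tilde A SR SC (t - 1) - Lambda_tilde A SR SC t)\<bar>
     \<le> 2 * sqrt \<delta> * L\<^sup>2 * dim_row A * dim_col A" by (simp add: z_def)
qed

text \<open>Rows are sampled well with probability at least 5/6, and then columns likewise whatever
  good row sample occurred; 25/36 exceeds 2/3.\<close>

lemma sv_procedure_correct:
  fixes A :: "real mat" and L k \<epsilon> :: real
  assumes A: "A \<in> carrier_mat n m" and n: "n \<ge> 1" and m: "m \<ge> 1" and L: "L > 0"
    and bound: "\<And>i j. i < n \<Longrightarrow> j < m \<Longrightarrow> \<bar>A $$ (i, j)\<bar> \<le> L"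
    and \<epsilon>: "\<epsilon> > 0" and t: "t \<ge> 1"
    and k: "n \<le> k \<and> m \<le> k \<or> k \<ge> 48 \<and> 48 / k \<le> \<epsilon>\<^sup>2 / 4"
  shows "measure_pmf.prob (sv_procedure A k t)
     {out. \<exists>z. out = Some z \<and> \<bar>singular_value t A - z\<bar> \<le> L * sqrt (\<epsilon> * real t * real n * real m)} \<ge> 2 / 3"
    (is "measure_pmf.prob _ ?X \<ge> _")
proof -
  have dim: "dim_row A = n" "dim_col A = m" using A by auto
  \<comment> \<open>Chosen so that 2 sqrt \<delta> = \<epsilon>.\<close>
  let ?\<delta> = "\<epsilon>\<^sup>2 / 4"
  let ?R = "\<lambda>SR. mat (card SR) m (\<lambda>(i, j). A $$ (pick SR i, j))"
  let ?row = "good_sample n m L k ?\<delta> (\<lambda>i a. A $$ (i, a))"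
  let ?col = "\<lambda>SR. good_sample m (card SR) L k ?\<delta> (\<lambda>j a. ?R SR $$ (a, j))"
  let ?out = "\<lambda>SR SC. if real (card SR) > 2 * k \<or> real (card SC) > 2 * k \<or> SR = {} \<or> SC = {} then None
    else Some (sqrt (Lambda_tilde A SR SC (t - 1) - Lambda_tilde A SR SC t))"
  have out: "?out SR SC \<in> ?X" if SR: "?row SR" and SC: "?col SR SC" for SR SC
  proof -
    let ?z = "Lambda_tilde A SR SC (t - 1) - Lambda_tilde A SR SC t"
    have est: "\<bar>error_drop t A - ?z\<bar> \<le> 2 * sqrt ?\<delta> * L\<^sup>2 * n * m" "?z \<ge> 0"
      using good_samples_estimate[OF t _ _ _ SR[folded dim] SC[folded dim]] n m by (simp_all add: dim)
    have "\<bar>singular_value t A - sqrt ?z\<bar> \<le> sqrt \<bar>error_drop t A - ?z\<bar>"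
      unfolding singular_value_error_drop[OF t] by (rule abs_sqrt_diff_le[OF error_drop_nonneg[OF t] est(2)])
    also have "\<dots> \<le> sqrt (L\<^sup>2 * (\<epsilon> * t * n * m))"
    proof (rule real_sqrt_le_mono)
      have "\<bar>error_drop t A - ?z\<bar> \<le> L\<^sup>2 * (\<epsilon> * 1 * n * m)"
        using est(1) \<epsilon> by (simp add: real_sqrt_divide algebra_simps)
      also have "\<dots> \<le> L\<^sup>2 * (\<epsilon> * t * n * m)" using t \<epsilon> by (intro mult_left_mono mult_right_mono) auto
      finally show "\<bar>error_drop t A - ?z\<bar> \<le> L\<^sup>2 * (\<epsilon> * t * n * m)" .
    qed
    also have "\<dots> = L * sqrt (\<epsilon> * t * n * m)" using L by (simp add: real_sqrt_mult)
    \<comment> \<open>Good samples are nonempty and have at most \<open>2 * k\<close> elements, so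
      an output is produced.\<close>
    finally show ?thesis using SR SC by (auto simp: good_sample_def)
  qed
  have "5 / 6 * (5 / 6) \<le> measure_pmf.prob (sv_procedure A k t) ?X"
    unfolding sv_procedure_def dim
  proof (rule prob_bind_pmf_ge[where S = "{SR. ?row SR}"])
    show "5 / 6 \<le> measure_pmf.prob (random_subset n (k / n)) {SR. ?row SR}"
      using n m L k bound by (intro prob_good_sample) auto
  next
    fix SR assume "SR \<in> {SR. ?row SR}"
    then have SR: "?row SR" by simp
    then have sub: "SR \<subseteq> {..<n}" and ne: "SR \<noteq> {}" by (auto simp: good_sample_def)
    then have card: "card SR > 0" using finite_subset[OF sub] by (auto simp: card_gt_0_iff)
    have "5 / 6 \<le> measure_pmf.prob (random_subset m (k / m)) {SC. ?col SR SC}"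
    proof (rule prob_good_sample)
      fix j a assume "j < m" "a < card SR"
      then show "\<bar>?R SR $$ (a, j)\<bar> \<le> L"
        using pick_in_set_le[of a SR] sub by (auto intro!: bound)
    qed (use m L k card in auto)
    also have "\<dots> \<le> measure_pmf.prob (random_subset m (k / m)) ((\<lambda>SC. ?out SR SC) -` ?X)"
      using out[OF SR] by (intro measure_pmf.finite_measure_mono subsetI) (simp_all only: vimage_eq mem_Collect_eq[of _ "?col SR"] sets_measure_pmf UNIV_I)
    also have "\<dots> = measure_pmf.prob (bind_pmf (random_subset m (k / m)) (\<lambda>SC. return_pmf (?out SR SC))) ?X"
      unfolding map_pmf_def[symmetric] by (rule measure_map_pmf[symmetric])
    finally show "5 / 6 \<le> measure_pmf.prob (bind_pmf (random_subset m (k / m)) (\<lambda>SC. return_pmf (?out SR SC))) ?X" .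
  qed simp
  then show ?thesis by simp
qed

section \<open>The sample size\<close>

text \<open>The logarithmic term vanishes only for \<open>n = m = 1\<close>, where the power is at
  least 1 and the whole matrix is sampled. Otherwise ln 2 is at least 1/2, which gives 1000 / 4 =
  250.\<close>

lemma sample_size_large:
  assumes n: "n \<ge> 1" and m: "m \<ge> 1" and \<epsilon>: "0 < \<epsilon>" "\<epsilon> < 1"
  shows "real n \<le> sample_size 1000 n m \<epsilon> \<and> real m \<le> sample_size 1000 n m \<epsilon> \<or>
    sample_size 1000 n m \<epsilon> \<ge> 250 / \<epsilon>\<^sup>2"
proof (cases "n = 1 \<and> m = 1")
  case True
  have "(1 / \<epsilon>) powr (1000 / \<epsilon>\<^sup>2) \<ge> 1" using \<epsilon> by (intro ge_one_powr_ge_zero) auto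
  then show ?thesis using True by (auto simp: sample_size_def)
next
  case False
  have ln: "(ln (real d))\<^sup>2 \<ge> 1 / 4" if "d \<ge> 2" for d :: nat
  proof -
    have "1 / 2 \<le> ln (2 :: real)" using ln2_ge_two_thirds by simp
    also have "\<dots> \<le> ln (real d)" using that by simp
    finally have "(1 / 2)\<^sup>2 \<le> (ln (real d))\<^sup>2" by (intro power_mono) auto
    then show ?thesis by (simp add: power2_eq_square)
  qed
  have "n \<ge> 2 \<or> m \<ge> 2" using False n m by auto
  then have "max ((ln (real n))\<^sup>2) ((ln (real m))\<^sup>2) \<ge> 1 / 4" using ln[of n] ln[of m] by auto
  then have "1000 * max ((ln (real n))\<^sup>2) ((ln (real m))\<^sup>2) / \<epsilon>\<^sup>2 \<ge> 250 / \<epsilon>\<^sup>2"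
    by (intro divide_right_mono) auto
  then show ?thesis by (auto simp: sample_size_def)
qed

theorem theorem5p5:
  shows "\<exists>C::real. C > 0 \<and>
    (\<forall>(n::nat) (m::nat) (L::real) (A::real mat) (\<epsilon>::real) (t::nat).
       n \<ge> 1 \<longrightarrow> m \<ge> 1 \<longrightarrow> L > 0 \<longrightarrow>
       A \<in> carrier_mat n m \<longrightarrow> (\<forall>i<n. \<forall>j<m. A $$ (i, j) \<in> {-L..L}) \<longrightarrow>
       0 < \<epsilon> \<longrightarrow> \<epsilon> < 1 \<longrightarrow>
       t \<ge> 1 \<longrightarrow> real t \<le> sample_size C n m \<epsilon> \<longrightarrow>
       measure_pmf.prob (sv_procedure A (sample_size C n m \<epsilon>) t)
         {out. \<exists>z. out = Some z \<and> \<bar>singular_value t A - z\<bar> \<le> L * sqrt (\<epsilon> * real t * real n * real m)}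
       \<ge> 2 / 3)"
proof (intro exI[of _ 1000] conjI allI impI)
  fix n m :: nat and L :: real and A :: "real mat" and \<epsilon> :: real and t :: nat
  assume n: "n \<ge> 1" and m: "m \<ge> 1" and L: "L > 0" and A: "A \<in> carrier_mat n m"
    and bound: "\<forall>i<n. \<forall>j<m. A $$ (i, j) \<in> {-L..L}" and \<epsilon>: "0 < \<epsilon>" "\<epsilon> < 1" and t: "t \<ge> 1"
  have entry: "\<bar>A $$ (i, j)\<bar> \<le> L" if "i < n" "j < m" for i j
  proof -
    have "A $$ (i, j) \<in> {-L..L}" using bound that by blast
    then show ?thesis by auto
  qed
  let ?k = "sample_size 1000 n m \<epsilon>"
  \<comment> \<open>The second bound amounts to \<open>?k \<ge> 192 / \<epsilon>\<^sup>2\<close>,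
    which 250 exceeds; the first holds because \<epsilon> < 1.\<close>
  have "?k \<ge> 48 \<and> 48 / ?k \<le> \<epsilon>\<^sup>2 / 4" if large: "?k \<ge> 250 / \<epsilon>\<^sup>2"
  proof -
    have "\<epsilon>\<^sup>2 \<le> 1" using \<epsilon> by (simp add: power_le_one)
    then have "250 \<le> 250 / \<epsilon>\<^sup>2" using \<epsilon> by (simp add: field_simps)
    moreover have "48 / ?k \<le> 48 / (250 / \<epsilon>\<^sup>2)" using large \<epsilon> by (intro frac_le) auto
    moreover have "48 / (250 / \<epsilon>\<^sup>2) \<le> \<epsilon>\<^sup>2 / 4" by simp
    ultimately show ?thesis using large by linarith
  qed
  then have "real n \<le> ?k \<and> real m \<le> ?k \<or> ?k \<ge> 48 \<and> 48 / ?k \<le> \<epsilon>\<^sup>2 / 4"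
    using sample_size_large[OF n m \<epsilon>] by blast
  then show "measure_pmf.prob (sv_procedure A ?k t)
      {out. \<exists>z. out = Some z \<and> \<bar>singular_value t A - z\<bar> \<le> L * sqrt (\<epsilon> * real t * real n * real m)} \<ge> 2 / 3"
    using A n m L entry \<epsilon> t by (intro sv_procedure_correct) auto
qed simp

end
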